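(* Let $Y$ be a perfectly normal Lindelöf topological space equipped with a continuous scaling $T_t$ and the ideal $\mathcal{Y}$ generated by a continuous finite modulus $\tau$. Let $Z=Y\times(0,\infty)$ with the ideal $\mathcal{Z}$ generated by the sets $Y\times B$ for $B\subset(0,\infty)$ with $\inf B>0$, and with the scaling $T^Z_t(y,s)=(y,ts)$. Let $(\eta,\zeta)$ be a random element in $Y\times(0,\infty)$ such that $$(\eta,\zeta)\in\mathrm{RV}(Z,T^Z,\mathcal{Z},g,\sigma\otimes\theta_\alpha),$$ where $\alpha>0$ and $\sigma$ is a finite Borel measure on $Y$ with $\sigma(\{\tau>0\})>0$. Furthermore, assume that, for some $\delta>0$ and $C<\infty$, $$\mathbf{E}\big[\tau(\eta)^{\alpha+\delta}\mid\zeta\big]\le C\quad\text{a.s. on }\{\zeta>0\}.$$ Then $T_\zeta\eta\in\mathrm{RV}(Y,T,\mathcal{Y},g,\mu)$, where $\mu$ is the pushforward of the product measure $\sigma\otimes\theta_\alpha$ under the map $(y,s)\mapsto T_sy$.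
   Context: A space is perfectly normal if any two disjoint closed sets are precisely separated by a continuous function to $[0,1]$ (equal to $0$ exactly on the first and $1$ exactly on the second); then Baire and Borel $\sigma$-algebras coincide. A space is Lindelöf if it is Hausdorff and each open cover has a countable subcover. A continuous scaling is a family of maps $T_t$, $t>0$, with $T_tT_s=T_{ts}$, $T_1=\mathrm{id}$, and $(y,t)\mapsto T_ty$ jointly continuous. A continuous finite modulus is a continuous $\tau:Y\to[0,\infty)$ with $\tau(T_ty)=t\tau(y)$; the ideal it generates is $\mathcal{Y}=\{A\subset Y:\inf_A\tau>0\}$. The measure $\theta_\alpha$ on $(0,\infty)$ is $\theta_\alpha(ds)=\alpha s^{-\alpha-1}ds$. An ideal is a family of subsets closed under finite unions and subsets; the ideal generated by a collection is the smallest ideal containing it. For a space $X$ with scaling $T$, ideal $\mathcal{S}$ with union $U_{\mathcal{S}}$, and a random element $\xi$, $\xi\in\mathrm{RV}(X,T,\mathcal{S},g,\mu)$ means: $g:[0,\infty)\to[0,\infty)$ is measurable with $g(t)\to\infty$ as $t\to\infty$; $\mu$ is a measure which is finite on measurable sets in $\mathcal{S}$, supported by $U_{\mathcal{S}}$, with $\mu(B)>0$ for some $B\in\mathcal{S}$; and $g(t)\mathbf{E}f(T_{t^{-1}}\xi)\to\int f\,d\mu$ as $t\to\infty$ for all bounded continuous $f:U_{\mathcal{S}}\to\mathbb{R}$ whose support (closure in $X$ of $\{f\ne0\}$) belongs to $\mathcal{S}$ (extended by zero). Convention: tail measures are considered only on sets from the ideal, so the pushforward $\mu$ is understood as restricted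 to $\{\tau>0\}$. *)

theory Defs
  imports "HOL-Probability.Probability"
begin

definition perfectly_normal_space :: "'a topology \<Rightarrow> bool" where
  "perfectly_normal_space X \<longleftrightarrow>
     (\<forall>A B. closedin X A \<and> closedin X B \<and> disjnt A B \<longrightarrow>
        (\<exists>f. continuous_map X (top_of_set {0..1::real}) f \<and>
             (\<forall>x\<in>topspace X. (f x = 0 \<longleftrightarrow> x \<in> A) \<and> (f x = 1 \<longleftrightarrow> x \<in> B))))"

definition borel_of :: "'a topology \<Rightarrow> 'a measure" where
  "borel_of X = sigma (topspace X) {U. openin X U}"

text \<open>The value of \<open>T t\<close> is irrelevant for \<open>t \<le> 0\<close> and outside the carrier.
  That \<open>T t\<close> maps the carrier to itself is part of the joint continuity.\<close>

definition continuous_scaling :: "'a topology \<Rightarrow> (real \<Rightarrow> 'a \<Rightarrow> 'a) \<Rightarrow> bool" where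
  "continuous_scaling X T \<longleftrightarrow>
     (\<forall>t>0. \<forall>s>0. \<forall>x\<in>topspace X. T t (T s x) = T (t * s) x) \<and>
     (\<forall>x\<in>topspace X. T 1 x = x) \<and>
     continuous_map (prod_topology X (top_of_set {0<..})) X (\<lambda>(x, t). T t x)"

definition continuous_finite_modulus ::
    "'a topology \<Rightarrow> (real \<Rightarrow> 'a \<Rightarrow> 'a) \<Rightarrow> ('a \<Rightarrow> real) \<Rightarrow> bool" where
  "continuous_finite_modulus X T \<tau> \<longleftrightarrow>
     continuous_map X (top_of_set {0..}) \<tau> \<and>
     (\<forall>t>0. \<forall>x\<in>topspace X. \<tau> (T t x) = t * \<tau> x)"

text \<open>The infimum is taken in the extended reals, so that the empty set, whose infimum
  is \<open>\<infinity>\<close>, belongs to the ideal.\<close>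

definition modulus_ideal :: "'a topology \<Rightarrow> ('a \<Rightarrow> real) \<Rightarrow> 'a set set" where
  "modulus_ideal X \<tau> = {A. A \<subseteq> topspace X \<and> 0 < (INF x\<in>A. ereal (\<tau> x))}"

definition set_ideal :: "'a set set \<Rightarrow> bool" where
  "set_ideal \<I> \<longleftrightarrow>
     (\<forall>\<F>. finite \<F> \<and> \<F> \<subseteq> \<I> \<longrightarrow> \<Union>\<F> \<in> \<I>) \<and>
     (\<forall>A\<in>\<I>. \<forall>B. B \<subseteq> A \<longrightarrow> B \<in> \<I>)"

definition generated_ideal :: "'a set set \<Rightarrow> 'a set set" where
  "generated_ideal \<G> = \<Inter>{\<I>. set_ideal \<I> \<and> \<G> \<subseteq> \<I>}"

text \<open>Regular variation of the random element \<open>\<xi>\<close> defined on \<open>M\<close>. The test functions on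
  \<open>\<Union>\<S>\<close> are represented by their extensions by zero to the whole type.
  The measure \<open>\<mu>\<close> lives on the whole of \<open>X\<close> and is concentrated on \<open>\<Union>\<S>\<close>.\<close>

definition regularly_varying ::
    "'w measure \<Rightarrow> ('w \<Rightarrow> 'a) \<Rightarrow> 'a topology \<Rightarrow> (real \<Rightarrow> 'a \<Rightarrow> 'a) \<Rightarrow> 'a set set \<Rightarrow>
     (real \<Rightarrow> real) \<Rightarrow> 'a measure \<Rightarrow> bool" where
  "regularly_varying M \<xi> X T \<S> g \<mu> \<longleftrightarrow>
     \<xi> \<in> measurable M (borel_of X) \<and>
     g \<in> borel_measurable (restrict_space borel {0..}) \<and>
     (\<forall>t\<ge>0. 0 \<le> g t) \<and>
     filterlim g at_top at_top \<and>
     sets \<mu> = sets (borel_of X) \<and>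
     (\<forall>B\<in>\<S> \<inter> sets \<mu>. emeasure \<mu> B < \<infinity>) \<and>
     (AE x in \<mu>. x \<in> \<Union>\<S>) \<and>
     (\<exists>B\<in>\<S> \<inter> sets \<mu>. 0 < emeasure \<mu> B) \<and>
     (\<forall>f::'a \<Rightarrow> real.
        continuous_map (subtopology X (\<Union>\<S>)) euclideanreal f \<and>
        bounded (f ` \<Union>\<S>) \<and>
        (\<forall>x. x \<notin> \<Union>\<S> \<longrightarrow> f x = 0) \<and>
        X closure_of {x. f x \<noteq> 0} \<in> \<S> \<longrightarrow>
        ((\<lambda>t. g t * (LINT \<omega>|M. f (T (inverse t) (\<xi> \<omega>)))) \<longlongrightarrow> (LINT x|\<mu>. f x)) at_top)"

definition theta :: "real \<Rightarrow> real measure" where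
  "theta \<alpha> = density (restrict_space lborel {0<..}) (\<lambda>s. ennreal (\<alpha> * s powr (- \<alpha> - 1)))"

end

theory Submission
  imports Defs
begin

text \<open>
  Let \<open>p = \<alpha> + \<delta>\<close>. For a test function \<open>f\<close> on
  \<open>Y\<close>, supported in \<open>{\<tau> \<ge> c}\<close> with \<open>c > 0\<close>,
  the composition \<open>F (y, s) = f (T s y)\<close> is bounded and continuous on \<open>Y
  \<times> (0, \<infinity>)\<close>, and the scaling property gives \<open>f (T (1 / t) (T
  \<zeta> \<eta>)) = F (\<eta>, \<zeta> / t)\<close>. The assertion is therefore the
  convergence of \<open>g t * E F (\<eta>, \<zeta> / t)\<close> to the integral of
  \<open>F\<close> with respect to \<open>\<nu> = \<sigma> \<Otimes>\<^sub>M theta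
  \<alpha>\<close>. The obstacle is that \<open>F\<close> is supported in \<open>{(y, s).
  \<tau> y * s \<ge> c}\<close>, which reaches down to \<open>s = 0\<close> if
  \<open>\<tau>\<close> is unbounded, so \<open>F\<close> need not be a test function for the
  pair.

  After multiplication by a continuous cutoff that vanishes for small \<open>s\<close> it is
  one. What is cut off is governed by the event \<open>\<tau> \<eta> * \<zeta> / t \<ge> c,
  \<zeta> / t \<le> r\<close>. Markov's inequality of order \<open>p\<close> together with the
  conditional moment bound reduces its probability to the truncated moment \<open>E (\<zeta> /
  t) ^ p\<close> on \<open>\<zeta> / t \<le> r\<close>. As \<open>\<zeta>\<close> has a
  regularly varying tail of index \<open>- \<alpha>\<close> and \<open>p > \<alpha>\<close>,
  Karamata's theorem bounds this moment by \<open>r ^ p\<close> times the tail of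
  \<open>\<zeta>\<close> at \<open>r * t\<close> (\<open>truncated_moment_le_tail\<close>,
  from a contracting recursion over halvings of \<open>t\<close>). Normalised by \<open>g
  t\<close>, the event thus has asymptotic probability of order at most \<open>r ^
  \<delta>\<close> (\<open>product_tail_small_radius\<close>).

  This estimate is used twice: it shows that \<open>\<nu>\<close> is finite on \<open>{(y, s).
  \<tau> y * s \<ge> c}\<close> (\<open>emeasure_tail_finite\<close>), which is the finiteness
  of \<open>\<mu>\<close> on the ideal and the domination needed for letting \<open>r\<close>
  tend to \<open>0\<close> in the limit integrals, and it permits the interchange of the
  limits in \<open>r\<close> and \<open>t\<close> (\<open>tendsto_tail_function\<close>).
\<close>

section \<open>Borel sets and continuous functions of an abstract topology\<close>

lemma space_borel_of: "space (borel_of X) = topspace X"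
  and sets_borel_of: "sets (borel_of X) = sigma_sets (topspace X) {U. openin X U}"
  by (auto simp: borel_of_def space_measure_of_conv intro!: sets_measure_of dest: openin_subset)

lemma measurable_borel_of_continuous_map:
  assumes "continuous_map X Y f"
  shows "f \<in> measurable (borel_of X) (borel_of Y)"
  unfolding borel_of_def[of Y]
proof (rule measurable_measure_of)
  show "f \<in> space (borel_of X) \<rightarrow> topspace Y"
    using assms by (auto simp: space_borel_of continuous_map_def)
  fix U assume "U \<in> {U. openin Y U}"
  then have "openin X (f -` U \<inter> topspace X)"
    using assms by (simp add: continuous_map_def vimage_def Int_def conj_commute)
  then show "f -` U \<inter> space (borel_of X) \<in> sets (borel_of X)"
    by (simp add: space_borel_of sets_borel_of)
qed (auto dest: openin_subset)

lemma borel_measurable_continuous_map: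
  fixes f :: "'a \<Rightarrow> 'b::topological_space"
  assumes "continuous_map X euclidean f"
  shows "f \<in> borel_measurable (borel_of X)"
  using measurable_borel_of_continuous_map[OF assms]
  by (simp add: borel_of_def[of euclidean] borel_def)

lemma borel_of_openin: "openin X U \<Longrightarrow> U \<in> sets (borel_of X)"
  by (simp add: sets_borel_of)

lemma borel_of_closedin:
  assumes "closedin X S"
  shows "S \<in> sets (borel_of X)"
proof -
  have "space (borel_of X) - (topspace X - S) \<in> sets (borel_of X)"
    using assms by (intro sets.compl_sets borel_of_openin openin_diff openin_topspace)
  then show ?thesis
    using closedin_subset[OF assms] by (simp add: space_borel_of Diff_Diff_Int Int_absorb1)
qed

text \<open>
  Test functions are continuous only on the union of the ideal. Away from the closure of
  \<open>{x. f x \<noteq> 0}\<close> the function vanishes, so the open set \<open>U\<close>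
  and the complement of that closure form an open cover on each member of which
  \<open>f\<close> is continuous.
\<close>

lemma continuous_map_extend_by_zero:
  fixes f :: "'a \<Rightarrow> real"
  assumes U: "openin X U" and f: "continuous_map (subtopology X U) euclideanreal f"
    and zero: "\<And>x. x \<notin> U \<Longrightarrow> f x = 0" and supp: "X closure_of {x. f x \<noteq> 0} \<subseteq> U"
  shows "continuous_map X euclideanreal f"
  unfolding continuous_map_def
proof (intro conjI allI impI)
  fix V :: "real set" assume V: "openin euclideanreal V"
  let ?N = "topspace X - X closure_of {x. f x \<noteq> 0}"
  have "openin (subtopology X U) {x \<in> topspace (subtopology X U). f x \<in> V}"
    using f V unfolding continuous_map_def by blast
  then have 1: "openin X {x \<in> topspace X. x \<in> U \<and> f x \<in> V}"
    using U by (auto simp: openin_open_subtopology)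
  have 2: "openin X ?N" by (intro openin_diff openin_topspace closedin_closure_of)
  have "{x. f x \<noteq> 0} \<subseteq> topspace X" using zero openin_subset[OF U] by blast
  then have "{x. f x \<noteq> 0} \<subseteq> X closure_of {x. f x \<noteq> 0}" by (rule closure_of_subset)
  then have N: "f x = 0" if "x \<in> ?N" for x using that by blast
  show "openin X {x \<in> topspace X. f x \<in> V}"
  proof (cases "0 \<in> V")
    case True
    then have "{x \<in> topspace X. f x \<in> V} = {x \<in> topspace X. x \<in> U \<and> f x \<in> V} \<union> ?N"
      using N supp by auto
    then show ?thesis using 1 2 by auto
  next
    case False
    then have "{x \<in> topspace X. f x \<in> V} = {x \<in> topspace X. x \<in> U \<and> f x \<in> V}"
      using zero by force
    then show ?thesis using 1 by simp
  qed
qed simp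

section \<open>The ideals of the two spaces\<close>

lemma INF_ereal_pos_iff:
  "0 < (INF x\<in>A. ereal (f x)) \<longleftrightarrow> (\<exists>c>0. \<forall>x\<in>A. c \<le> f x)"
proof
  assume "0 < (INF x\<in>A. ereal (f x))"
  then obtain c where c: "0 < ereal c" "ereal c < (INF x\<in>A. ereal (f x))"
    using ereal_dense2 by blast
  have "c \<le> f x" if "x \<in> A" for x
    using less_le_trans[OF c(2) INF_lower[OF that]] by simp
  with c show "\<exists>c>0. \<forall>x\<in>A. c \<le> f x" by auto
next
  assume "\<exists>c>0. \<forall>x\<in>A. c \<le> f x"
  then obtain c where c: "c > 0" "\<forall>x\<in>A. c \<le> f x" by blast
  then have "ereal c \<le> (INF x\<in>A. ereal (f x))" by (intro INF_greatest) simp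
  with c show "0 < (INF x\<in>A. ereal (f x))"
    using less_le_trans[of 0 "ereal c"] by simp
qed

lemma modulus_ideal_iff:
  "A \<in> modulus_ideal X \<tau> \<longleftrightarrow> A \<subseteq> topspace X \<and> (\<exists>c>0. \<forall>x\<in>A. c \<le> \<tau> x)"
  by (simp add: modulus_ideal_def INF_ereal_pos_iff)

lemma Union_modulus_ideal: "\<Union>(modulus_ideal X \<tau>) = {x \<in> topspace X. 0 < \<tau> x}"
proof
  show "{x \<in> topspace X. 0 < \<tau> x} \<subseteq> \<Union>(modulus_ideal X \<tau>)"
  proof
    fix x assume "x \<in> {x \<in> topspace X. 0 < \<tau> x}"
    then have "{x} \<in> modulus_ideal X \<tau>"
      unfolding modulus_ideal_iff by (intro conjI exI[of _ "\<tau> x"]) simp_all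
    then show "x \<in> \<Union>(modulus_ideal X \<tau>)" by blast
  qed
next
  show "\<Union>(modulus_ideal X \<tau>) \<subseteq> {x \<in> topspace X. 0 < \<tau> x}"
  proof
    fix x assume "x \<in> \<Union>(modulus_ideal X \<tau>)"
    then obtain A where "x \<in> A" and A: "A \<in> modulus_ideal X \<tau>" by (rule UnionE)
    from A obtain c where "c > 0" "\<forall>x\<in>A. c \<le> \<tau> x" "A \<subseteq> topspace X"
      by (auto simp only: modulus_ideal_iff)
    with \<open>x \<in> A\<close> have "x \<in> topspace X" "c \<le> \<tau> x" by auto
    with \<open>c > 0\<close> show "x \<in> {x \<in> topspace X. 0 < \<tau> x}" by simp
  qed
qed

lemma set_ideal_cylinder_subsets: "set_ideal {A. \<exists>r>0. A \<subseteq> X \<times> {r::real..}}" (is "set_ideal ?I")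
  unfolding set_ideal_def
proof (intro conjI allI impI ballI)
  fix \<F> assume "finite \<F> \<and> \<F> \<subseteq> ?I"
  then have "finite \<F>" "\<F> \<subseteq> ?I" by blast+
  then show "\<Union>\<F> \<in> ?I"
  proof (induction \<F> rule: finite_induct)
    case empty
    show ?case by (auto intro: exI[of _ 1])
  next
    case (insert A \<F>)
    from insert.prems obtain r where r: "r > 0" "A \<subseteq> X \<times> {r..}" by blast
    from insert.prems insert.IH obtain r' where r': "r' > 0" "\<Union>\<F> \<subseteq> X \<times> {r'..}" by blast
    have "X \<times> {r..} \<union> X \<times> {r'..} \<subseteq> X \<times> {min r r'..}" by auto
    with r r' have "\<Union>(insert A \<F>) \<subseteq> X \<times> {min r r'..}" "min r r' > 0"
      unfolding Union_insert by (blast, simp)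
    then show ?case by blast
  qed
next
  fix A B assume "A \<in> ?I" "B \<subseteq> A"
  then show "B \<in> ?I" by blast
qed

text \<open>
  The sets lying above some positive height already form an ideal, so generating adds nothing
  to them. This makes membership in the ideal of the product space checkable by exhibiting one
  height.
\<close>

lemma generated_ideal_cylinders:
  "generated_ideal {X \<times> B |B. B \<subseteq> {0<..} \<and> 0 < (INF s\<in>B. ereal s)} =
     {A. \<exists>r>0. A \<subseteq> X \<times> {r::real..}}" (is "generated_ideal ?G = ?I")
proof
  have "?G \<subseteq> ?I"
  proof
    fix A assume "A \<in> ?G"
    then obtain B where "A = X \<times> B" "0 < (INF s\<in>B. ereal s)" by blast
    then obtain c where "A = X \<times> B" "c > 0" "\<forall>s\<in>B. c \<le> s"
      using INF_ereal_pos_iff[of "\<lambda>s. s" B] by blast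
    then show "A \<in> ?I" by (intro CollectI exI[of _ c]) auto
  qed
  with set_ideal_cylinder_subsets show "generated_ideal ?G \<subseteq> ?I"
    unfolding generated_ideal_def by (intro Inter_lower) simp
next
  show "?I \<subseteq> generated_ideal ?G"
    unfolding generated_ideal_def
  proof (intro subsetI InterI)
    fix A \<I> assume "A \<in> ?I" and \<I>: "\<I> \<in> {\<I>. set_ideal \<I> \<and> ?G \<subseteq> \<I>}"
    from \<open>A \<in> ?I\<close> obtain r where r: "r > 0" "A \<subseteq> X \<times> {r..}" by blast
    then have "0 < (INF s\<in>{r..}. ereal s)"
      using INF_ereal_pos_iff[of "\<lambda>s. s" "{r..}"] by auto
    with r have "X \<times> {r..} \<in> ?G" by (intro CollectI exI[of _ "{r..}"]) auto
    moreover from \<I> have "set_ideal \<I>" "?G \<subseteq> \<I>" by simp_all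
    ultimately show "A \<in> \<I>" using r unfolding set_ideal_def by (meson subsetD)
  qed
qed

section \<open>Homogeneity of the radial measure\<close>

lemma space_theta: "space (theta \<alpha>) = {0<..}"
  and sets_theta: "sets (theta \<alpha>) = sets (restrict_space borel {0<..})"
  by (simp_all add: theta_def space_restrict_space sets_restrict_space)

lemma sigma_finite_theta: "sigma_finite_measure (theta \<alpha>)"
proof -
  interpret S: sigma_finite_measure "restrict_space lborel {0::real<..}"
    by (intro sigma_finite_measure_restrict_space sigma_finite_lborel) simp
  show ?thesis
    unfolding theta_def
    by (subst S.sigma_finite_iff_density_finite) (auto intro!: measurable_restrict_space1)
qed

lemma nn_integral_theta:
  assumes "f \<in> borel_measurable borel"
  shows "(\<integral>\<^sup>+s. f s \<partial>theta \<alpha>) =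
    (\<integral>\<^sup>+s. ennreal (\<alpha> * s powr (- \<alpha> - 1)) * f s * indicator {0<..} s \<partial>lborel)"
  unfolding theta_def using assms
  by (subst nn_integral_density)
     (auto intro!: measurable_restrict_space1 simp: nn_integral_restrict_space)

text \<open>
  This homogeneity is how the exponent \<open>\<alpha>\<close> enters the tail estimates: it
  makes the limits of the normalised tails of \<open>\<zeta>\<close> proportional to \<open>r
  powr - \<alpha>\<close>.
\<close>

lemma nn_integral_theta_scale:
  assumes f[measurable]: "f \<in> borel_measurable borel" and "0 < r"
  shows "(\<integral>\<^sup>+s. f (s / r) \<partial>theta \<alpha>) = ennreal (r powr - \<alpha>) * (\<integral>\<^sup>+s. f s \<partial>theta \<alpha>)"
proof -
  have "(\<integral>\<^sup>+s. f (s / r) \<partial>theta \<alpha>) =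
      (\<integral>\<^sup>+s. ennreal (\<alpha> * s powr (- \<alpha> - 1)) * f (s / r) * indicator {0<..} s \<partial>lborel)"
    by (rule nn_integral_theta) simp
  also have "\<dots> = ennreal r * (\<integral>\<^sup>+s. ennreal (\<alpha> * (r * s) powr (- \<alpha> - 1)) * f s * indicator {0<..} s \<partial>lborel)"
    using \<open>0 < r\<close>
    by (subst nn_integral_real_affine[where c = r and t = 0])
       (auto intro!: arg_cong2[of _ _ _ _ "(*)"] nn_integral_cong
             simp: indicator_def zero_less_mult_iff)
  also have "\<dots> = (\<integral>\<^sup>+s. ennreal (r powr - \<alpha>) * (ennreal (\<alpha> * s powr (- \<alpha> - 1)) * f s * indicator {0<..} s) \<partial>lborel)"
  proof (subst nn_integral_cmult[symmetric]; (intro nn_integral_cong)?)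
    fix s :: real
    show "ennreal r * (ennreal (\<alpha> * (r * s) powr (- \<alpha> - 1)) * f s * indicator {0<..} s) =
       ennreal (r powr - \<alpha>) * (ennreal (\<alpha> * s powr (- \<alpha> - 1)) * f s * indicator {0<..} s)"
    proof (cases "0 < s")
      case True
      then have "r * (\<alpha> * (r * s) powr (- \<alpha> - 1)) = r powr - \<alpha> * (\<alpha> * s powr (- \<alpha> - 1))"
        using \<open>0 < r\<close> powr_add[of r 1 "- \<alpha> - 1"] by (simp add: powr_mult)
      then have "ennreal r * ennreal (\<alpha> * (r * s) powr (- \<alpha> - 1)) =
          ennreal (r powr - \<alpha>) * ennreal (\<alpha> * s powr (- \<alpha> - 1))"
        using \<open>0 < r\<close> by (metis ennreal_mult' less_imp_le powr_ge_zero)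
      then show ?thesis by (simp only: mult.assoc[symmetric])
    qed simp
  qed simp
  also have "\<dots> = ennreal (r powr - \<alpha>) * (\<integral>\<^sup>+s. f s \<partial>theta \<alpha>)"
    by (subst nn_integral_cmult) (simp_all add: nn_integral_theta)
  finally show ?thesis .
qed

lemma nn_integral_pair_theta_snd:
  assumes f: "f \<in> borel_measurable borel"
  shows "(\<integral>\<^sup>+z. f (snd z) \<partial>(\<sigma> \<Otimes>\<^sub>M theta \<alpha>)) = emeasure \<sigma> (space \<sigma>) * (\<integral>\<^sup>+s. f s \<partial>theta \<alpha>)"
proof -
  have "f \<in> borel_measurable (theta \<alpha>)"
    using measurable_restrict_space1[OF f] by (simp add: sets_theta cong: measurable_cong_sets)
  then have "(\<lambda>z. f (snd z)) \<in> borel_measurable (\<sigma> \<Otimes>\<^sub>M theta \<alpha>)"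
    by (rule measurable_compose[OF measurable_snd])
  from sigma_finite_measure.nn_integral_fst[OF sigma_finite_theta this]
  show ?thesis by (simp add: mult.commute)
qed

lemma nn_integral_pair_theta_scale:
  assumes "f \<in> borel_measurable borel" and "0 < r"
  shows "(\<integral>\<^sup>+z. f (snd z / r) \<partial>(\<sigma> \<Otimes>\<^sub>M theta \<alpha>)) =
    ennreal (r powr - \<alpha>) * (\<integral>\<^sup>+z. f (snd z) \<partial>(\<sigma> \<Otimes>\<^sub>M theta \<alpha>))"
proof -
  have "(\<lambda>s. f (s / r)) \<in> borel_measurable borel" using assms(1) by measurable
  from nn_integral_pair_theta_snd[OF this] show ?thesis
    by (simp only: nn_integral_pair_theta_snd[OF assms(1)] nn_integral_theta_scale[OF assms] mult.left_commute)
qed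

section \<open>Truncated moments of regularly varying tails\<close>

text \<open>
  A continuous substitute for the indicator of \<open>{1..}\<close>, so that tail events can
  be used as test functions.
\<close>

definition cutoff :: "real \<Rightarrow> real" where
  "cutoff s = min 1 (max 0 (2 * s - 1))"

lemma cutoff_nonneg: "0 \<le> cutoff s" and cutoff_le_1: "cutoff s \<le> 1"
  and cutoff_eq_0: "s \<le> 1/2 \<Longrightarrow> cutoff s = 0" and cutoff_eq_1: "1 \<le> s \<Longrightarrow> cutoff s = 1"
  by (auto simp: cutoff_def)

lemma abs_cutoff_le_1: "\<bar>cutoff s\<bar> \<le> 1"
  by (simp add: cutoff_def)

lemma cutoff_mono: "s \<le> s' \<Longrightarrow> cutoff s \<le> cutoff s'"
  by (auto simp: cutoff_def)

lemma continuous_on_cutoff: "continuous_on UNIV cutoff"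
  unfolding cutoff_def by (intro continuous_intros)

lemma borel_measurable_cutoff [measurable]: "cutoff \<in> borel_measurable borel"
  by (rule borel_measurable_continuous_onI[OF continuous_on_cutoff])

text \<open>
  A discrete form of Karamata's theorem. Dividing the recursion by \<open>U t\<close>, the
  ratio \<open>R t = W t / U t\<close> satisfies \<open>R t \<le> \<kappa> * lam * R (t / 2) +
  lam\<close>. As \<open>\<kappa> * lam < 1\<close>, this affine map has the fixed point
  \<open>lam / (1 - \<kappa> * lam)\<close>, which bounds \<open>R\<close> once the initial
  dyadic block \<open>{t0..2 * t0}\<close> is bounded.
\<close>

lemma dyadic_recursion_bound:
  fixes U W :: "real \<Rightarrow> real"
  assumes "0 < t0" and "0 \<le> \<kappa>" "0 \<le> lam" "\<kappa> * lam < 1"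
    and pos: "\<And>t. t0 \<le> t \<Longrightarrow> 0 < U t"
    and anti: "\<And>s t. t0 \<le> s \<Longrightarrow> s \<le> t \<Longrightarrow> U t \<le> U s"
    and W1: "\<And>t. t0 \<le> t \<Longrightarrow> W t \<le> 1"
    and rec: "\<And>t. 2 * t0 \<le> t \<Longrightarrow> W t \<le> \<kappa> * W (t / 2) + U (t / 2)"
    and dbl: "\<And>t. 2 * t0 \<le> t \<Longrightarrow> U (t / 2) \<le> lam * U t"
  shows "\<exists>B\<ge>0. \<forall>t\<ge>t0. W t \<le> B * U t"
proof -
  define B where "B = max (1 / U (2 * t0)) (lam / (1 - \<kappa> * lam))"
  have "0 < U (2 * t0)" using pos[of "2 * t0"] \<open>0 < t0\<close> by simp
  moreover have "1 / U (2 * t0) \<le> B" by (simp add: B_def)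
  ultimately have B1: "0 < B" "1 \<le> B * U (2 * t0)"
    using less_le_trans[of 0 "1 / U (2 * t0)" B] by (simp_all add: field_simps)
  have "lam / (1 - \<kappa> * lam) \<le> B" by (simp add: B_def)
  then have B2: "(\<kappa> * B + 1) * lam \<le> B" using \<open>\<kappa> * lam < 1\<close> by (simp add: field_simps)
  \<comment> \<open>Halving stays above \<open>t0\<close> until the initial block is reached, which gives an induction on the number of halvings.\<close>
  have "W t \<le> B * U t" if "t0 \<le> t" "t \<le> 2 ^ Suc n * t0" for n t
    using that
  proof (induction n arbitrary: t)
    case 0
    then have "t \<le> 2 * t0" by simp
    have "B * U (2 * t0) \<le> B * U t"
      using anti[OF \<open>t0 \<le> t\<close> \<open>t \<le> 2 * t0\<close>] B1 by simp
    with W1[OF \<open>t0 \<le> t\<close>] B1 show ?case by linarith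
  next
    case (Suc n)
    show ?case
    proof (cases "t \<le> 2 * t0")
      case True
      have "B * U (2 * t0) \<le> B * U t"
        using anti[OF \<open>t0 \<le> t\<close> True] B1 by simp
      with W1[OF \<open>t0 \<le> t\<close>] B1 show ?thesis by linarith
    next
      case False
      then have t: "2 * t0 \<le> t" "t0 \<le> t / 2" by simp_all
      have "W (t / 2) \<le> B * U (t / 2)"
        using t Suc.prems by (intro Suc.IH) auto
      then have "\<kappa> * W (t / 2) \<le> \<kappa> * (B * U (t / 2))"
        using \<open>0 \<le> \<kappa>\<close> by (rule mult_left_mono)
      with rec[OF t(1)] have "W t \<le> (\<kappa> * B + 1) * U (t / 2)"
        by (simp add: algebra_simps)
      also have "\<dots> \<le> (\<kappa> * B + 1) * (lam * U t)"
        using dbl[OF t(1)] B1 \<open>0 \<le> \<kappa>\<close> by (intro mult_left_mono) auto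
      also have "\<dots> \<le> B * U t"
        using mult_right_mono[OF B2, of "U t"] pos[OF Suc.prems(1)] by (simp add: mult.assoc)
      finally show ?thesis .
    qed
  qed
  moreover have "\<exists>n. t \<le> 2 ^ Suc n * t0" for t
  proof -
    obtain n where "t / t0 < 2 ^ n" using real_arch_pow[of 2 "t / t0"] by auto
    then have "t < 2 ^ n * t0" using \<open>0 < t0\<close> by (simp add: field_simps)
    also have "\<dots> \<le> 2 ^ Suc n * t0" using \<open>0 < t0\<close> by simp
    finally show ?thesis by (blast intro: less_imp_le)
  qed
  ultimately show ?thesis using B1 by (meson less_imp_le)
qed

text \<open>
  How a conditional moment bound is used: a factor depending only on the conditioning variable
  can be kept while the conditioned one is replaced by its bound.
\<close>

lemma nn_integral_mult_le_of_nn_cond_exp_le: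
  fixes Z :: "'w \<Rightarrow> real" and X :: "'w \<Rightarrow> ennreal" and k :: "real \<Rightarrow> ennreal"
  assumes "prob_space M" and Z: "Z \<in> borel_measurable M" and X: "X \<in> borel_measurable M"
    and k: "k \<in> borel_measurable borel"
    and bound: "AE \<omega> in M. nn_cond_exp M (vimage_algebra (space M) Z borel) X \<omega> \<le> C"
  shows "(\<integral>\<^sup>+\<omega>. k (Z \<omega>) * X \<omega> \<partial>M) \<le> C * (\<integral>\<^sup>+\<omega>. k (Z \<omega>) \<partial>M)"
proof -
  interpret prob_space M by fact
  let ?F = "vimage_algebra (space M) Z borel"
  have "subalgebra M ?F"
    using Z by (auto simp: subalgebra_def sets_vimage_algebra2 measurable_sets)
  then interpret finite_measure_subalgebra M ?F
    by unfold_locales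
  have "Z \<in> borel_measurable ?F" by (rule measurable_vimage_algebra1) simp
  then have kF: "(\<lambda>\<omega>. k (Z \<omega>)) \<in> borel_measurable ?F"
    using k by (rule measurable_compose)
  have [measurable]: "(\<lambda>\<omega>. k (Z \<omega>)) \<in> borel_measurable M"
    using measurable_compose[OF Z k] .
  have "(\<integral>\<^sup>+\<omega>. k (Z \<omega>) * X \<omega> \<partial>M) = (\<integral>\<^sup>+\<omega>. k (Z \<omega>) * nn_cond_exp M ?F X \<omega> \<partial>M)"
    by (rule nn_cond_exp_intg[OF kF X, symmetric])
  also have "\<dots> \<le> (\<integral>\<^sup>+\<omega>. C * k (Z \<omega>) \<partial>M)"
    using bound by (intro nn_integral_mono_AE) (auto elim!: eventually_mono intro: mult_left_mono simp: mult.commute[of C])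
  also have "\<dots> = C * (\<integral>\<^sup>+\<omega>. k (Z \<omega>) \<partial>M)" by (rule nn_integral_cmult) simp
  finally show ?thesis .
qed

lemma min_1_powr_le_1:
  fixes x p :: real
  assumes "0 < x" "0 < p"
  shows "min 1 x powr p \<le> 1"
proof -
  have "min 1 x powr p \<le> 1 powr p" using assms by (intro powr_mono2) auto
  then show ?thesis by simp
qed

text \<open>
  The pointwise source of the dyadic recursion for truncated moments: below \<open>1/2\<close>
  the truncation is not felt and the power scales exactly, above \<open>1/2\<close> the tail
  term dominates.
\<close>

lemma min_1_powr_le_halve:
  fixes x p :: real
  assumes "0 < x" "0 < p"
  shows "min 1 x powr p \<le> 2 powr - p * min 1 (2 * x) powr p + cutoff (2 * x)"
proof (cases "x < 1/2")
  case True
  then have "min 1 x powr p = 2 powr - p * min 1 (2 * x) powr p"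
    using assms by (simp add: powr_mult powr_add[symmetric] mult.assoc[symmetric] min_def)
  then show ?thesis using cutoff_nonneg[of "2 * x"] by simp
next
  case False
  then have "cutoff (2 * x) = 1" by (intro cutoff_eq_1) simp
  with min_1_powr_le_1[OF assms] show ?thesis by (simp add: add_increasing)
qed

text \<open>
  The Karamata estimate for truncated moments of order \<open>p > \<alpha>\<close>. The
  assumption on \<open>g\<close> says that the smoothed tail \<open>U t\<close> is regularly
  varying of index \<open>- \<alpha>\<close>, hence \<open>U (t / 2) / U t\<close> tends to
  \<open>2 powr \<alpha>\<close>. Moments of order \<open>p\<close> shrink by the factor
  \<open>2 powr - p\<close> under the same rescaling, and \<open>2 powr (\<alpha> - p) <
  1\<close> makes the dyadic recursion contract.
\<close>

lemma truncated_moment_le_tail: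
  fixes Z :: "'w \<Rightarrow> real"
  assumes "prob_space M" and Z[measurable]: "Z \<in> borel_measurable M"
    and Zpos: "\<And>\<omega>. \<omega> \<in> space M \<Longrightarrow> 0 < Z \<omega>"
    and "0 < \<alpha>" "\<alpha> < p" "0 < A" and g: "\<And>t. 0 \<le> t \<Longrightarrow> 0 \<le> g t"
    and lim: "\<And>r. 0 < r \<Longrightarrow> ((\<lambda>t. g t * (LINT \<omega>|M. cutoff (Z \<omega> / (r * t)))) \<longlongrightarrow> r powr - \<alpha> * A) at_top"
  shows "\<exists>B\<ge>0. \<forall>\<^sub>F t in at_top.
    (LINT \<omega>|M. min 1 (Z \<omega> / t) powr p) \<le> B * (LINT \<omega>|M. cutoff (Z \<omega> / t))"
proof -
  interpret prob_space M by fact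
  define U where "U t = (LINT \<omega>|M. cutoff (Z \<omega> / t))" for t
  define W where "W t = (LINT \<omega>|M. min 1 (Z \<omega> / t) powr p)" for t
  have "0 < p" using assms by simp
  \<comment> \<open>Any number strictly between \<open>2 powr \<alpha>\<close> and \<open>2 powr p\<close> would do.\<close>
  define lam where "lam = 2 powr ((\<alpha> + p) / 2)"
  have intU: "integrable M (\<lambda>\<omega>. cutoff (Z \<omega> / t))" for t
    by (rule integrable_const_bound[where B = 1]) (auto simp: abs_cutoff_le_1)
  have le1: "min 1 (Z \<omega> / t) powr p \<le> 1" if "\<omega> \<in> space M" "0 < t" for \<omega> t
    using Zpos[OF that(1)] that(2) \<open>0 < p\<close> by (intro min_1_powr_le_1) simp_all
  have intW: "integrable M (\<lambda>\<omega>. min 1 (Z \<omega> / t) powr p)" if "0 < t" for t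
    using le1 that by (intro integrable_const_bound[where B = 1]) auto
  have W1: "W t \<le> 1" if "0 < t" for t
    unfolding W_def using integral_mono[OF intW[OF that] integrable_const[of 1]] le1 that
    by (simp add: prob_space)
  have rec: "W t \<le> 2 powr - p * W (t / 2) + U (t / 2)" if "0 < t" for t
  proof -
    have "integrable M (\<lambda>\<omega>. 2 powr - p * min 1 (Z \<omega> / (t / 2)) powr p + cutoff (Z \<omega> / (t / 2)))"
      using that by (intro Bochner_Integration.integrable_add integrable_mult_right intW intU) simp
    note int = intW[OF that] this
    have "W t \<le> (LINT \<omega>|M. 2 powr - p * min 1 (Z \<omega> / (t / 2)) powr p + cutoff (Z \<omega> / (t / 2)))"
      unfolding W_def
    proof (rule integral_mono)
      fix \<omega> assume "\<omega> \<in> space M"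
      then have "0 < Z \<omega> / t" using Zpos that by simp
      from min_1_powr_le_halve[OF this, of p] assms
      show "min 1 (Z \<omega> / t) powr p \<le> 2 powr - p * min 1 (Z \<omega> / (t / 2)) powr p + cutoff (Z \<omega> / (t / 2))"
        by (simp add: mult.commute)
    qed (rule int)+
    also have "\<dots> = 2 powr - p * W (t / 2) + U (t / 2)"
      unfolding W_def U_def using intW[of "t / 2"] intU[of "t / 2"] that
      by (subst Bochner_Integration.integral_add) auto
    finally show ?thesis .
  qed
  have anti: "U t \<le> U s" if "0 < s" "s \<le> t" for s t
    unfolding U_def using Zpos that
    by (intro integral_mono intU cutoff_mono divide_left_mono) (auto intro: less_imp_le)
  have limU: "((\<lambda>t. g t * U t) \<longlongrightarrow> A) at_top"
    using lim[of 1] by (simp add: U_def)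
  have limU2: "((\<lambda>t. g t * U (t / 2)) \<longlongrightarrow> 2 powr \<alpha> * A) at_top"
    using lim[of "1/2"] by (simp add: U_def powr_minus_divide powr_divide)
  have "2 powr \<alpha> < lam" unfolding lam_def using assms by (intro powr_less_mono) auto
  have "((\<lambda>t. lam * (g t * U t) - g t * U (t / 2)) \<longlongrightarrow> lam * A - 2 powr \<alpha> * A) at_top"
    by (intro tendsto_intros limU limU2)
  moreover have "0 < lam * A - 2 powr \<alpha> * A"
    using \<open>2 powr \<alpha> < lam\<close> \<open>0 < A\<close> by simp
  ultimately have ev1: "\<forall>\<^sub>F t in at_top. 0 < lam * (g t * U t) - g t * U (t / 2)"
    by (rule order_tendstoD)
  have ev2: "\<forall>\<^sub>F t in at_top. 0 < g t * U t"
    using limU \<open>0 < A\<close> by (rule order_tendstoD)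
  \<comment> \<open>The normalisation \<open>g\<close> cancels: it is positive where \<open>g t * U t\<close> is.\<close>
  have "\<forall>\<^sub>F t in at_top. U (t / 2) \<le> lam * U t \<and> 0 < U t"
    using ev1 ev2 eventually_gt_at_top[of 0]
  proof eventually_elim
    case (elim t)
    then have "0 < g t" using g[of t] by (cases "g t = 0") auto
    with elim show ?case
      by (auto simp: zero_less_mult_iff mult.left_commute[of lam] right_diff_distrib[symmetric])
  qed
  then obtain t1 where t1: "\<And>t. t1 \<le> t \<Longrightarrow> U (t / 2) \<le> lam * U t \<and> 0 < U t"
    unfolding eventually_at_top_linorder by blast
  define t0 where "t0 = max 1 t1"
  have "2 powr - p * lam < 2 powr 0"
    unfolding lam_def powr_add[symmetric] using assms by (intro powr_less_mono) auto
  then have "2 powr - p * lam < 1" by simp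
  then have "\<exists>B\<ge>0. \<forall>t\<ge>t0. W t \<le> B * U t"
    using t1 W1 rec anti
    by (intro dyadic_recursion_bound[where \<kappa> = "2 powr - p" and lam = lam]) (auto simp: t0_def lam_def)
  then show ?thesis
    unfolding W_def U_def eventually_at_top_linorder by blast
qed

text \<open>
  The radial component contributes negligibly to the tail of a product when it is itself
  small. By Markov's inequality of order \<open>p\<close> and the conditional moment bound,
  the probability is at most a constant times \<open>r powr p * W (r * t)\<close>, where
  \<open>W\<close> is the truncated moment. The Karamata estimate replaces \<open>W (r *
  t)\<close> by \<open>U (r * t)\<close>, which after multiplication by \<open>g t\<close>
  tends to a multiple of \<open>r powr - \<alpha>\<close>. The resulting power \<open>r powr
  (p - \<alpha>)\<close> tends to zero with \<open>r\<close>, and the constant does not depend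
  on \<open>r\<close>.
\<close>

lemma product_tail_small_radius:
  fixes Z X :: "'w \<Rightarrow> real"
  assumes "prob_space M" and Z[measurable]: "Z \<in> borel_measurable M"
    and X[measurable]: "X \<in> borel_measurable M"
    and Zpos: "\<And>\<omega>. \<omega> \<in> space M \<Longrightarrow> 0 < Z \<omega>" and X0: "\<And>\<omega>. \<omega> \<in> space M \<Longrightarrow> 0 \<le> X \<omega>"
    and "0 < \<alpha>" "\<alpha> < p" "0 < A" "0 < c" and g: "\<And>t. 0 \<le> t \<Longrightarrow> 0 \<le> g t"
    and lim: "\<And>r. 0 < r \<Longrightarrow> ((\<lambda>t. g t * (LINT \<omega>|M. cutoff (Z \<omega> / (r * t)))) \<longlongrightarrow> r powr - \<alpha> * A) at_top"
    and "C < \<infinity>"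
    and bound: "AE \<omega> in M. nn_cond_exp M (vimage_algebra (space M) Z borel)
             (\<lambda>\<omega>. ennreal (X \<omega> powr p)) \<omega> \<le> C"
  shows "\<exists>D. \<forall>r>0. \<forall>\<^sub>F t in at_top.
    g t * measure M {\<omega>\<in>space M. c \<le> X \<omega> * (Z \<omega> / t) \<and> Z \<omega> / t \<le> r} \<le> D * r powr (p - \<alpha>)"
proof -
  interpret prob_space M by fact
  define U where "U t = (LINT \<omega>|M. cutoff (Z \<omega> / t))" for t
  define W where "W t = (LINT \<omega>|M. min 1 (Z \<omega> / t) powr p)" for t
  have "0 < p" using assms by simp
  obtain B where "0 \<le> B" and B: "\<forall>\<^sub>F t in at_top. W t \<le> B * U t"
    using truncated_moment_le_tail[OF \<open>prob_space M\<close> Z Zpos \<open>0 < \<alpha>\<close> \<open>\<alpha> < p\<close> \<open>0 < A\<close> g lim]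
    unfolding U_def W_def by blast
  obtain C' where C': "C = ennreal C'" "0 \<le> C'" using \<open>C < \<infinity>\<close> by (cases C) auto
  have le1: "min 1 (Z \<omega> / t) powr p \<le> 1" if "\<omega> \<in> space M" "0 < t" for \<omega> t
    using Zpos[OF that(1)] that(2) \<open>0 < p\<close> by (intro min_1_powr_le_1) simp_all
  have intW: "integrable M (\<lambda>\<omega>. min 1 (Z \<omega> / t) powr p)" if "0 < t" for t
    using le1 that by (intro integrable_const_bound[where B = 1]) auto
  have markov: "measure M {\<omega>\<in>space M. c \<le> X \<omega> * (Z \<omega> / t) \<and> Z \<omega> / t \<le> r}
      \<le> C' * (r / c) powr p * W (r * t)" (is "measure M ?S \<le> _") if "0 < t" "0 < r" for t r
  proof -
    define k where "k s = ennreal ((s / (t * c)) powr p) * indicator {0<..t * r} s" for s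
    have [measurable]: "k \<in> borel_measurable borel" unfolding k_def by measurable
    have "emeasure M ?S = (\<integral>\<^sup>+\<omega>. indicator ?S \<omega> \<partial>M)" by simp
    also have "\<dots> \<le> (\<integral>\<^sup>+\<omega>. k (Z \<omega>) * ennreal (X \<omega> powr p) \<partial>M)"
    proof (rule nn_integral_mono)
      fix \<omega> assume \<omega>: "\<omega> \<in> space M"
      show "indicator ?S \<omega> \<le> k (Z \<omega>) * ennreal (X \<omega> powr p)"
      proof (cases "\<omega> \<in> ?S")
        case True
        then have "1 \<le> Z \<omega> / (t * c) * X \<omega>" "Z \<omega> \<le> t * r"
          using \<open>0 < c\<close> \<open>0 < t\<close> by (auto simp: field_simps)
        then have "1 powr p \<le> (Z \<omega> / (t * c) * X \<omega>) powr p"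
          using \<open>0 < p\<close> by (intro powr_mono2) auto
        then have "1 \<le> ennreal ((Z \<omega> / (t * c)) powr p * X \<omega> powr p)"
          using X0[OF \<omega>] Zpos[OF \<omega>] that \<open>0 < c\<close>
          by (subst powr_mult[symmetric]) (auto simp del: ennreal_1 simp: ennreal_1[symmetric] intro!: ennreal_leI)
        then show ?thesis using True Zpos[OF \<omega>] \<open>Z \<omega> \<le> t * r\<close>
          by (simp add: k_def ennreal_mult)
      qed simp
    qed
    also have "\<dots> \<le> C * (\<integral>\<^sup>+\<omega>. k (Z \<omega>) \<partial>M)"
      by (rule nn_integral_mult_le_of_nn_cond_exp_le[OF \<open>prob_space M\<close> Z _ _ bound]) simp_all
    also have "(\<integral>\<^sup>+\<omega>. k (Z \<omega>) \<partial>M) \<le> (\<integral>\<^sup>+\<omega>. ennreal ((r / c) powr p * min 1 (Z \<omega> / (r * t)) powr p) \<partial>M)"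
    proof (rule nn_integral_mono)
      fix \<omega> assume \<omega>: "\<omega> \<in> space M"
      show "k (Z \<omega>) \<le> ennreal ((r / c) powr p * min 1 (Z \<omega> / (r * t)) powr p)"
      proof (cases "Z \<omega> \<le> t * r")
        case True
        then have "min 1 (Z \<omega> / (r * t)) = Z \<omega> / (r * t)"
          using that by (simp add: min_def field_simps)
        then have "r / c * min 1 (Z \<omega> / (r * t)) = Z \<omega> / (t * c)"
          using that by simp
        then have "(r / c) powr p * min 1 (Z \<omega> / (r * t)) powr p = (Z \<omega> / (t * c)) powr p"
          by (simp only: powr_mult[symmetric])
        then show ?thesis by (simp add: k_def indicator_def)
      qed (simp add: k_def)
    qed
    also have "\<dots> = ennreal ((r / c) powr p * W (r * t))"
      unfolding W_def using intW[of "r * t"] that by (subst nn_integral_eq_integral) auto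
    finally have "emeasure M ?S \<le> C * ennreal ((r / c) powr p * W (r * t))"
      by (simp add: mult_left_mono)
    also have "\<dots> = ennreal (C' * (r / c) powr p * W (r * t))"
      using C' by (simp add: ennreal_mult' mult.assoc)
    finally show ?thesis
      unfolding emeasure_eq_measure W_def using C' by (subst (asm) ennreal_le_iff) auto
  qed
  \<comment> \<open>The factor \<open>2\<close> absorbs the passage from the limit of \<open>g t * U (r * t)\<close> to an eventual bound.\<close>
  define D where "D = 2 * C' * c powr - p * B * A"
  show ?thesis
  proof (intro exI[of _ D] allI impI)
    fix r :: real assume "0 < r"
    have "\<forall>\<^sub>F t in at_top. W (r * t) \<le> B * U (r * t)"
      using B \<open>0 < r\<close> by (rule eventually_compose_filterlim[OF _ filterlim_tendsto_pos_mult_at_top[OF tendsto_const _ filterlim_ident]])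
    moreover have "\<forall>\<^sub>F t in at_top. g t * U (r * t) < 2 * (r powr - \<alpha> * A)"
      using lim[OF \<open>0 < r\<close>] \<open>0 < r\<close> \<open>0 < A\<close> unfolding U_def by (intro order_tendstoD(2)) auto
    ultimately show "\<forall>\<^sub>F t in at_top.
        g t * measure M {\<omega>\<in>space M. c \<le> X \<omega> * (Z \<omega> / t) \<and> Z \<omega> / t \<le> r} \<le> D * r powr (p - \<alpha>)"
      using eventually_gt_at_top[of 0]
    proof eventually_elim
      case (elim t)
      let ?K = "C' * (r / c) powr p"
      have "0 \<le> g t" "0 \<le> ?K" using g elim C' by auto
      have "g t * measure M {\<omega>\<in>space M. c \<le> X \<omega> * (Z \<omega> / t) \<and> Z \<omega> / t \<le> r} \<le> g t * (?K * W (r * t))"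
        using markov[OF \<open>0 < t\<close> \<open>0 < r\<close>] \<open>0 \<le> g t\<close> by (rule mult_left_mono)
      also have "\<dots> \<le> g t * (?K * (B * U (r * t)))"
        using elim(1) \<open>0 \<le> g t\<close> \<open>0 \<le> ?K\<close> by (intro mult_left_mono)
      also have "\<dots> = ?K * B * (g t * U (r * t))" by simp
      also have "\<dots> \<le> ?K * B * (2 * (r powr - \<alpha> * A))"
        using elim(2) \<open>0 \<le> ?K\<close> \<open>0 \<le> B\<close> by (intro mult_left_mono) auto
      also have "\<dots> = D * r powr (p - \<alpha>)"
        using \<open>0 < r\<close> \<open>0 < c\<close>
        by (simp add: D_def powr_diff powr_minus powr_divide field_simps)
      finally show ?case .
    qed
  qed
qed

section \<open>Interchange of limits\<close>

lemma tendsto_of_uniform_approximation: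
  fixes u :: "nat \<Rightarrow> 'a \<Rightarrow> real"
  assumes u: "\<And>n. (u n \<longlongrightarrow> J n) F" and J: "J \<longlonglongrightarrow> L" and e: "e \<longlonglongrightarrow> 0"
    and close: "\<And>n. \<forall>\<^sub>F t in F. \<bar>v t - u n t\<bar> \<le> e n"
  shows "(v \<longlongrightarrow> L) F"
proof (rule tendstoI)
  fix \<epsilon> :: real assume "0 < \<epsilon>"
  then have "\<forall>\<^sub>F n in sequentially. dist (J n) L < \<epsilon> / 3" "\<forall>\<^sub>F n in sequentially. dist (e n) 0 < \<epsilon> / 3"
    using tendstoD[OF J, of "\<epsilon> / 3"] tendstoD[OF e, of "\<epsilon> / 3"] by simp_all
  then have "\<forall>\<^sub>F n in sequentially. dist (J n) L < \<epsilon> / 3 \<and> dist (e n) 0 < \<epsilon> / 3"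
    by eventually_elim simp
  then obtain n where n: "dist (J n) L < \<epsilon> / 3" "dist (e n) 0 < \<epsilon> / 3"
    unfolding eventually_sequentially by blast
  have "\<forall>\<^sub>F t in F. dist (u n t) (J n) < \<epsilon> / 3"
    using tendstoD[OF u[of n], of "\<epsilon> / 3"] \<open>0 < \<epsilon>\<close> by simp
  with close[of n] show "\<forall>\<^sub>F t in F. dist (v t) L < \<epsilon>"
  proof eventually_elim
    case (elim t)
    with n show ?case unfolding dist_real_def by linarith
  qed
qed

text \<open>
  The setting for passing from test functions supported at positive height in the second
  coordinate to functions supported where \<open>\<tau> (fst z) * snd z\<close> is bounded
  below. For a point scaled by its second coordinate, this product is the value of the
  modulus.
\<close>

locale regularly_varying_pair = prob_space M
  for M :: "'w measure" and Y :: "'a topology" and \<tau> :: "'a \<Rightarrow> real"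
    and \<eta> :: "'w \<Rightarrow> 'a" and \<zeta> :: "'w \<Rightarrow> real" and g :: "real \<Rightarrow> real"
    and \<sigma> :: "'a measure" and \<alpha> p :: real and C :: ennreal +
  assumes rv: "regularly_varying M (\<lambda>\<omega>. (\<eta> \<omega>, \<zeta> \<omega>))
           (prod_topology Y (top_of_set {0<..})) (\<lambda>t (y, s). (y, t * s))
           (generated_ideal {topspace Y \<times> B |B. B \<subseteq> {0<..} \<and> 0 < (INF s\<in>B. ereal s)})
           g (\<sigma> \<Otimes>\<^sub>M theta \<alpha>)"
    and alpha_pos: "0 < \<alpha>" and alpha_less_p: "\<alpha> < p"
    and continuous_modulus: "continuous_map Y euclideanreal \<tau>"
    and modulus_nonneg: "\<And>y. y \<in> topspace Y \<Longrightarrow> 0 \<le> \<tau> y"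
    and C_finite: "C < \<infinity>"
    and moment_bound: "AE \<omega> in M. 0 < \<zeta> \<omega> \<longrightarrow> nn_cond_exp M (vimage_algebra (space M) \<zeta> borel)
             (\<lambda>\<omega>. ennreal (\<tau> (\<eta> \<omega>) powr p)) \<omega> \<le> C"
begin

abbreviation Z :: "('a \<times> real) topology" where
  "Z \<equiv> prod_topology Y (top_of_set {0<..})"

abbreviation \<nu> :: "('a \<times> real) measure" where
  "\<nu> \<equiv> \<sigma> \<Otimes>\<^sub>M theta \<alpha>"

lemma
  shows pair_measurable: "(\<lambda>\<omega>. (\<eta> \<omega>, \<zeta> \<omega>)) \<in> measurable M (borel_of Z)"
    and g_measurable: "g \<in> borel_measurable (restrict_space borel {0..})"
    and g_nonneg: "0 \<le> t \<Longrightarrow> 0 \<le> g t"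
    and g_at_top: "filterlim g at_top at_top"
    and sets_nu: "sets \<nu> = sets (borel_of Z)"
    and finite_on_ideal: "B \<in> sets \<nu> \<Longrightarrow> 0 < r \<Longrightarrow> B \<subseteq> topspace Y \<times> {r..} \<Longrightarrow> emeasure \<nu> B < \<infinity>"
    and positive_on_ideal: "\<exists>B r. 0 < r \<and> B \<subseteq> topspace Y \<times> {r..} \<and> B \<in> sets \<nu> \<and> 0 < emeasure \<nu> B"
proof -
  note R = rv[unfolded regularly_varying_def generated_ideal_cylinders]
  show "(\<lambda>\<omega>. (\<eta> \<omega>, \<zeta> \<omega>)) \<in> measurable M (borel_of Z)" "g \<in> borel_measurable (restrict_space borel {0..})"
    "0 \<le> t \<Longrightarrow> 0 \<le> g t" "filterlim g at_top at_top" "sets \<nu> = sets (borel_of Z)"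
    using R by simp_all
  show "emeasure \<nu> B < \<infinity>" if "B \<in> sets \<nu>" "0 < r" "B \<subseteq> topspace Y \<times> {r..}"
    using R that by blast
  have "\<exists>B\<in>{A. \<exists>r>0. A \<subseteq> topspace Y \<times> {r..}} \<inter> sets \<nu>. 0 < emeasure \<nu> B"
    using R by (elim conjE)
  then show "\<exists>B r. 0 < r \<and> B \<subseteq> topspace Y \<times> {r..} \<and> B \<in> sets \<nu> \<and> 0 < emeasure \<nu> B"
    by blast
qed

lemma space_nu: "space \<nu> = topspace Y \<times> {0<..}"
  using sets_eq_imp_space_eq[OF sets_nu] by (simp add: space_borel_of)

lemma pair_in_space:
  assumes "\<omega> \<in> space M"
  shows "\<eta> \<omega> \<in> topspace Y" "0 < \<zeta> \<omega>"
  using measurable_space[OF pair_measurable assms] by (simp_all add: space_borel_of)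

lemma continuous_snd: "continuous_map Z euclideanreal snd"
  using continuous_map_into_fulltopology[OF continuous_map_snd] .

lemma continuous_modulus_fst: "continuous_map Z euclideanreal (\<lambda>z. \<tau> (fst z))"
  using continuous_map_compose[OF continuous_map_fst continuous_modulus] by (simp add: comp_def)

lemma continuous_cutoff:
  assumes "continuous_map Z euclideanreal f"
  shows "continuous_map Z euclideanreal (\<lambda>z. cutoff (f z))"
  using continuous_map_compose[OF assms, of euclideanreal cutoff] continuous_on_cutoff
  by (simp add: comp_def)

lemma measurable_nu:
  fixes F :: "'a \<times> real \<Rightarrow> real"
  assumes "continuous_map Z euclideanreal F"
  shows "F \<in> borel_measurable \<nu>"
  using borel_measurable_continuous_map[OF assms] by (simp add: measurable_cong_sets[OF sets_nu])

lemma measurable_pair: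
  fixes F :: "'a \<times> real \<Rightarrow> real"
  assumes "continuous_map Z euclideanreal F" "0 < t"
  shows "(\<lambda>\<omega>. F (\<eta> \<omega>, \<zeta> \<omega> / t)) \<in> borel_measurable M"
proof -
  have "continuous_map Z (top_of_set {0<..}) (\<lambda>z. snd z / t)"
    using \<open>0 < t\<close>
    by (auto simp: continuous_map_in_subtopology intro!: continuous_map_real_divide continuous_snd)
  then have "continuous_map Z Z (\<lambda>z. (fst z, snd z / t))"
    by (intro continuous_map_pairedI continuous_map_fst)
  from continuous_map_compose[OF this assms(1)]
  have "(\<lambda>z. F (fst z, snd z / t)) \<in> borel_measurable (borel_of Z)"
    by (intro borel_measurable_continuous_map) (simp add: comp_def)
  from measurable_compose[OF pair_measurable this] show ?thesis by simp
qed

lemma zeta_measurable [measurable]: "\<zeta> \<in> borel_measurable M"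
  using measurable_pair[OF continuous_snd, of 1] by simp

lemma modulus_measurable [measurable]: "(\<lambda>\<omega>. \<tau> (\<eta> \<omega>)) \<in> borel_measurable M"
  using measurable_pair[OF continuous_modulus_fst, of 1] by simp

text \<open>
  The regular variation hypothesis with the ideal and the closure of the support replaced by a
  pointwise condition on the second coordinate, so that it applies to functions given by formulas.
\<close>

lemma tendsto_test_function:
  assumes F: "continuous_map Z euclideanreal F"
    and bounded: "\<And>z. z \<in> topspace Z \<Longrightarrow> \<bar>F z\<bar> \<le> K"
    and "0 < r" and supp: "\<And>z. z \<in> topspace Z \<Longrightarrow> F z \<noteq> 0 \<Longrightarrow> r \<le> snd z"
  shows "((\<lambda>t. g t * (LINT \<omega>|M. F (\<eta> \<omega>, \<zeta> \<omega> / t))) \<longlongrightarrow> (LINT z|\<nu>. F z)) at_top"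
proof -
  define F' where "F' z = (if z \<in> topspace Z then F z else 0)" for z
  let ?I = "{A. \<exists>r>0. A \<subseteq> topspace Y \<times> {r::real..}}"
  have Un: "\<Union>?I = topspace Z"
  proof
    show "topspace Z \<subseteq> \<Union>?I"
    proof
      fix z assume "z \<in> topspace Z"
      then have "z \<in> topspace Y \<times> {snd z..}" "0 < snd z" by (auto simp: mem_Times_iff)
      then show "z \<in> \<Union>?I" by blast
    qed
  qed auto
  have "continuous_map (subtopology Z (\<Union>?I)) euclideanreal F'"
    unfolding Un subtopology_topspace by (rule continuous_map_eq[OF F]) (simp add: F'_def)
  moreover have "bounded (F' ` \<Union>?I)"
    unfolding Un using bounded by (auto simp: bounded_iff F'_def intro!: exI[of _ K])
  moreover have "\<forall>z. z \<notin> \<Union>?I \<longrightarrow> F' z = 0"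
    unfolding Un by (simp add: F'_def)
  moreover have "Z closure_of {z. F' z \<noteq> 0} \<in> ?I"
  proof -
    have "closedin (top_of_set {0<..}) {r..}"
      using \<open>0 < r\<close> by (auto simp: closedin_closed intro!: exI[of _ "{r..}"])
    then have "closedin Z (topspace Y \<times> {r..})"
      by (simp add: closedin_prod_Times_iff)
    moreover have "{z. F' z \<noteq> 0} \<subseteq> topspace Y \<times> {r..}"
      using supp by (auto simp: F'_def split: if_splits)
    ultimately have "Z closure_of {z. F' z \<noteq> 0} \<subseteq> topspace Y \<times> {r..}"
      by (intro closure_of_minimal)
    with \<open>0 < r\<close> show ?thesis by blast
  qed
  ultimately have "((\<lambda>t. g t * (LINT \<omega>|M. F' ((\<lambda>t (y, s). (y, t * s)) (inverse t) (\<eta> \<omega>, \<zeta> \<omega>)))) \<longlongrightarrow> (LINT z|\<nu>. F' z)) at_top"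
    using rv unfolding regularly_varying_def generated_ideal_cylinders by (elim conjE allE[of _ F']) simp
  moreover have "(LINT z|\<nu>. F' z) = (LINT z|\<nu>. F z)"
    by (intro Bochner_Integration.integral_cong) (auto simp: F'_def space_nu)
  moreover have "\<forall>\<^sub>F t in at_top. g t * (LINT \<omega>|M. F' ((\<lambda>t (y, s). (y, t * s)) (inverse t) (\<eta> \<omega>, \<zeta> \<omega>))) =
      g t * (LINT \<omega>|M. F (\<eta> \<omega>, \<zeta> \<omega> / t))"
    using eventually_gt_at_top[of 0]
  proof eventually_elim
    case (elim t)
    then show ?case
      by (intro arg_cong[of _ _ "(*) (g t)"] Bochner_Integration.integral_cong)
         (auto simp: F'_def pair_in_space divide_inverse mult.commute)
  qed
  ultimately show ?thesis by (auto elim: Lim_transform_eventually)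
qed

lemma nn_integral_cutoff_snd:
  assumes "0 < r"
  shows "(\<integral>\<^sup>+z. ennreal (cutoff (snd z / r)) \<partial>\<nu>) = ennreal (r powr - \<alpha>) * (\<integral>\<^sup>+z. ennreal (cutoff (snd z)) \<partial>\<nu>)"
  using nn_integral_pair_theta_scale[of "\<lambda>s. ennreal (cutoff s)", OF _ assms] by simp

lemma nn_integral_cutoff_snd_finite: "(\<integral>\<^sup>+z. ennreal (cutoff (snd z)) \<partial>\<nu>) < \<infinity>"
proof -
  let ?S = "{z \<in> space \<nu>. 1/2 \<le> snd z}"
  have S: "?S \<in> sets \<nu>" using measurable_nu[OF continuous_snd] by measurable
  have "(\<integral>\<^sup>+z. ennreal (cutoff (snd z)) \<partial>\<nu>) \<le> (\<integral>\<^sup>+z. indicator ?S z \<partial>\<nu>)"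
  proof (rule nn_integral_mono)
    fix z assume "z \<in> space \<nu>"
    then show "ennreal (cutoff (snd z)) \<le> indicator ?S z"
      using cutoff_le_1[of "snd z"] cutoff_eq_0[of "snd z"] by (auto simp: indicator_def)
  qed
  also have "\<dots> = emeasure \<nu> ?S" using S by simp
  also have "\<dots> < \<infinity>"
    using S by (rule finite_on_ideal[where r = "1/2"]) (auto simp: space_nu)
  finally show ?thesis .
qed

text \<open>
  Some set of the ideal has positive mass. It lies above some height \<open>r\<close>, and
  homogeneity transports this height to \<open>1\<close>.
\<close>

lemma nn_integral_cutoff_snd_positive: "0 < (\<integral>\<^sup>+z. ennreal (cutoff (snd z)) \<partial>\<nu>)"
proof -
  obtain B r where "0 < r" and B: "B \<subseteq> topspace Y \<times> {r..}" "B \<in> sets \<nu>" "0 < emeasure \<nu> B"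
    using positive_on_ideal by blast
  have "emeasure \<nu> B = (\<integral>\<^sup>+z. indicator B z \<partial>\<nu>)" using B by simp
  also have "\<dots> \<le> (\<integral>\<^sup>+z. ennreal (cutoff (snd z / r)) \<partial>\<nu>)"
  proof (rule nn_integral_mono)
    fix z
    show "indicator B z \<le> ennreal (cutoff (snd z / r))"
    proof (cases "z \<in> B")
      case True
      then have "r \<le> snd z" using subsetD[OF B(1)] by (simp add: mem_Times_iff)
      then have "1 \<le> snd z / r" using \<open>0 < r\<close> by simp
      then show ?thesis using True by (simp add: cutoff_eq_1)
    qed simp
  qed
  finally have "0 < ennreal (r powr - \<alpha>) * (\<integral>\<^sup>+z. ennreal (cutoff (snd z)) \<partial>\<nu>)"
    using B(3) nn_integral_cutoff_snd[OF \<open>0 < r\<close>] by (simp add: less_le_trans)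
  then show ?thesis by (simp add: zero_less_iff_neq_zero)
qed

definition cutoff_mass :: real where "cutoff_mass = (LINT z|\<nu>. cutoff (snd z))"

lemma integral_cutoff_snd:
  assumes "0 < r"
  shows "(LINT z|\<nu>. cutoff (snd z / r)) = r powr - \<alpha> * cutoff_mass"
proof -
  have "(LINT z|\<nu>. cutoff (snd z / r)) = enn2real (\<integral>\<^sup>+z. ennreal (cutoff (snd z / r)) \<partial>\<nu>)" if "0 < r" for r
    using that
    by (intro integral_eq_nn_integral measurable_nu continuous_cutoff continuous_map_real_divide
        continuous_snd) (auto simp: cutoff_nonneg)
  from this[OF assms] this[of 1] show ?thesis
    by (simp add: cutoff_mass_def nn_integral_cutoff_snd[OF assms] enn2real_mult)
qed

lemma cutoff_mass_positive: "0 < cutoff_mass"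
proof -
  have "cutoff_mass = enn2real (\<integral>\<^sup>+z. ennreal (cutoff (snd z)) \<partial>\<nu>)"
    unfolding cutoff_mass_def
    by (intro integral_eq_nn_integral measurable_nu continuous_cutoff continuous_snd) (simp add: cutoff_nonneg)
  then show ?thesis
    using nn_integral_cutoff_snd_finite nn_integral_cutoff_snd_positive by (simp add: enn2real_positive_iff)
qed

lemma tendsto_cutoff:
  assumes "0 < r"
  shows "((\<lambda>t. g t * (LINT \<omega>|M. cutoff (\<zeta> \<omega> / (r * t)))) \<longlongrightarrow> r powr - \<alpha> * cutoff_mass) at_top"
proof -
  have "((\<lambda>t. g t * (LINT \<omega>|M. cutoff (snd (\<eta> \<omega>, \<zeta> \<omega> / t) / r))) \<longlongrightarrow> (LINT z|\<nu>. cutoff (snd z / r))) at_top"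
  proof (rule tendsto_test_function[where r = "r / 2" and K = 1])
    show "r / 2 \<le> snd z" if "cutoff (snd z / r) \<noteq> 0" for z :: "'a \<times> real"
      using that cutoff_eq_0[of "snd z / r"] assms by (auto simp: field_simps not_le intro: ccontr)
  qed (use assms in \<open>auto simp: abs_cutoff_le_1 intro!: continuous_cutoff continuous_map_real_divide continuous_snd\<close>)
  then show ?thesis
    by (simp add: integral_cutoff_snd[OF assms] mult.commute[of r])
qed

lemma joint_tail_small_radius:
  assumes "0 < c"
  shows "\<exists>D. \<forall>r>0. \<forall>\<^sub>F t in at_top.
    g t * measure M {\<omega>\<in>space M. c \<le> \<tau> (\<eta> \<omega>) * (\<zeta> \<omega> / t) \<and> \<zeta> \<omega> / t \<le> r} \<le> D * r powr (p - \<alpha>)"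
proof (rule product_tail_small_radius[OF _ zeta_measurable modulus_measurable _ _ alpha_pos
      alpha_less_p cutoff_mass_positive assms g_nonneg tendsto_cutoff C_finite])
  show "prob_space M" by unfold_locales
  show "AE \<omega> in M. nn_cond_exp M (vimage_algebra (space M) \<zeta> borel) (\<lambda>\<omega>. ennreal (\<tau> (\<eta> \<omega>) powr p)) \<omega> \<le> C"
    using moment_bound by (rule AE_mp) (simp add: pair_in_space)
qed (simp_all add: pair_in_space modulus_nonneg)

lemma tail_set_measurable: "{z \<in> space \<nu>. c \<le> \<tau> (fst z) * snd z} \<in> sets \<nu>"
  using measurable_nu[OF continuous_map_real_mult[OF continuous_modulus_fst continuous_snd]]
  by measurable

lemma cutoff_Suc_neq_0: "cutoff (real (Suc n) * s) \<noteq> 0 \<Longrightarrow> 1 / (2 * real (Suc n)) \<le> s"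
  using cutoff_eq_0[of "real (Suc n) * s"] by (auto simp: field_simps not_le intro: ccontr)

text \<open>
  The tail sets \<open>{z. c \<le> \<tau> (fst z) * snd z}\<close> come arbitrarily close to
  height zero when \<open>\<tau>\<close> is unbounded. They need not belong to the ideal then,
  and their finiteness comes from the moment bound. Smoothed indicators \<open>F n\<close> of
  their parts above height \<open>1 / Suc n\<close> are test functions, and their integrals
  are limits of normalised expectations. These are bounded uniformly in \<open>n\<close>:
  where the second coordinate exceeds \<open>1\<close> by the mass of the cutoff, elsewhere by
  the small-radius estimate with \<open>r = 1\<close>. Continuity of the measure from below
  removes the restriction on the height.
\<close>

lemma emeasure_tail_finite:
  assumes "0 < c"
  shows "emeasure \<nu> {z \<in> space \<nu>. c \<le> \<tau> (fst z) * snd z} < \<infinity>"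
proof -
  have "0 < c / 2" using assms by simp
  then obtain D where D': "\<forall>r>0. \<forall>\<^sub>F t in at_top.
      g t * measure M {\<omega>\<in>space M. c / 2 \<le> \<tau> (\<eta> \<omega>) * (\<zeta> \<omega> / t) \<and> \<zeta> \<omega> / t \<le> r} \<le> D * r powr (p - \<alpha>)"
    using joint_tail_small_radius by blast
  have D: "\<forall>\<^sub>F t in at_top.
      g t * measure M {\<omega>\<in>space M. c / 2 \<le> \<tau> (\<eta> \<omega>) * (\<zeta> \<omega> / t) \<and> \<zeta> \<omega> / t \<le> 1} \<le> D"
    using spec[OF D', of 1] by simp
  define F where "F n z = cutoff (\<tau> (fst z) * snd z / c) * cutoff (real (Suc n) * snd z)" for n and z :: "'a \<times> real"
  have F: "continuous_map Z euclideanreal (F n)" for n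
    unfolding F_def using assms
    by (intro continuous_map_real_mult continuous_cutoff continuous_map_real_divide
        continuous_modulus_fst continuous_snd) auto
  have F01: "0 \<le> F n z" "F n z \<le> 1" for n z
    unfolding F_def by (auto intro: mult_le_one simp: cutoff_nonneg cutoff_le_1)
  have F_tail: "F n z \<le> cutoff (real (Suc n) * snd z)" for n z
    unfolding F_def by (rule mult_left_le_one_le) (auto simp: cutoff_nonneg cutoff_le_1)
  have F_lim: "((\<lambda>t. g t * (LINT \<omega>|M. F n (\<eta> \<omega>, \<zeta> \<omega> / t))) \<longlongrightarrow> (LINT z|\<nu>. F n z)) at_top" for n
  proof (rule tendsto_test_function[OF F, where K = 1 and r = "1 / (2 * real (Suc n))"])
    show "1 / (2 * real (Suc n)) \<le> snd z" if "F n z \<noteq> 0" for z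
      using that cutoff_Suc_neq_0 by (auto simp: F_def simp del: of_nat_Suc)
  qed (use F01 in auto)
  have F_le: "(LINT z|\<nu>. F n z) \<le> cutoff_mass + 1 + D" for n
  proof (rule tendsto_upperbound[OF F_lim])
    have "\<forall>\<^sub>F t in at_top. g t * (LINT \<omega>|M. cutoff (\<zeta> \<omega> / t)) < cutoff_mass + 1"
      using tendsto_cutoff[of 1] by (intro order_tendstoD(2)) auto
    with D show "\<forall>\<^sub>F t in at_top. g t * (LINT \<omega>|M. F n (\<eta> \<omega>, \<zeta> \<omega> / t)) \<le> cutoff_mass + 1 + D"
      using eventually_gt_at_top[of 0]
    proof eventually_elim
      case (elim t)
      let ?S = "{\<omega>\<in>space M. c / 2 \<le> \<tau> (\<eta> \<omega>) * (\<zeta> \<omega> / t) \<and> \<zeta> \<omega> / t \<le> 1}"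
      have int: "integrable M (\<lambda>\<omega>. cutoff (\<zeta> \<omega> / t))" "integrable M (indicator ?S :: _ \<Rightarrow> real)"
        by (rule integrable_const_bound[where B = 1]; auto simp: abs_cutoff_le_1)+
      have "(LINT \<omega>|M. F n (\<eta> \<omega>, \<zeta> \<omega> / t)) \<le> (LINT \<omega>|M. cutoff (\<zeta> \<omega> / t) + indicator ?S \<omega>)"
      proof (rule integral_mono)
        show "integrable M (\<lambda>\<omega>. F n (\<eta> \<omega>, \<zeta> \<omega> / t))"
          using measurable_pair[OF F \<open>0 < t\<close>] F01 by (intro integrable_const_bound[where B = 1]) auto
        fix \<omega> assume "\<omega> \<in> space M"
        show "F n (\<eta> \<omega>, \<zeta> \<omega> / t) \<le> cutoff (\<zeta> \<omega> / t) + indicator ?S \<omega>"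
        proof (cases "1 \<le> \<zeta> \<omega> / t \<or> F n (\<eta> \<omega>, \<zeta> \<omega> / t) = 0")
          case True
          then show ?thesis
            using F01[of n "(\<eta> \<omega>, \<zeta> \<omega> / t)"] cutoff_eq_1[of "\<zeta> \<omega> / t"] cutoff_nonneg[of "\<zeta> \<omega> / t"]
            by (auto simp: indicator_def)
        next
          case False
          then have "cutoff (\<tau> (\<eta> \<omega>) * (\<zeta> \<omega> / t) / c) \<noteq> 0" by (auto simp: F_def)
          then have "\<not> \<tau> (\<eta> \<omega>) * (\<zeta> \<omega> / t) / c \<le> 1 / 2" using cutoff_eq_0 by blast
          then have "\<not> \<tau> (\<eta> \<omega>) * (\<zeta> \<omega> / t) \<le> 1 / 2 * c"
            by (simp only: pos_divide_le_eq[OF assms] simp_thms)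
          then have "c / 2 \<le> \<tau> (\<eta> \<omega>) * (\<zeta> \<omega> / t)" by simp
          with False \<open>\<omega> \<in> space M\<close> have "\<omega> \<in> ?S" by auto
          then show ?thesis
            using F01[of n "(\<eta> \<omega>, \<zeta> \<omega> / t)"] cutoff_nonneg[of "\<zeta> \<omega> / t"] by simp
        qed
      qed (use int in simp)
      also have "\<dots> = (LINT \<omega>|M. cutoff (\<zeta> \<omega> / t)) + measure M ?S"
        using int by simp
      finally have "g t * (LINT \<omega>|M. F n (\<eta> \<omega>, \<zeta> \<omega> / t)) \<le>
          g t * (LINT \<omega>|M. cutoff (\<zeta> \<omega> / t)) + g t * measure M ?S"
        using g_nonneg[of t] \<open>0 < t\<close> by (auto simp: distrib_left[symmetric] intro: mult_left_mono)
      with elim show ?case by linarith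
    qed
  qed simp
  \<comment> \<open>On \<open>S n\<close> both cutoff factors of \<open>F n\<close> equal \<open>1\<close>.\<close>
  define S where "S n = {z \<in> space \<nu>. c \<le> \<tau> (fst z) * snd z \<and> 1 \<le> real (Suc n) * snd z}" for n
  have S: "S n \<in> sets \<nu>" for n
  proof -
    have "{z \<in> space \<nu>. 1 \<le> real (Suc n) * snd z} \<in> sets \<nu>"
      using measurable_nu[OF continuous_snd] by measurable
    moreover have "S n = {z \<in> space \<nu>. c \<le> \<tau> (fst z) * snd z} \<inter> {z \<in> space \<nu>. 1 \<le> real (Suc n) * snd z}"
      by (auto simp: S_def)
    ultimately show ?thesis using tail_set_measurable by simp
  qed
  have "emeasure \<nu> (S n) \<le> ennreal (cutoff_mass + 1 + D)" for n
  proof -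
    have "(\<integral>\<^sup>+z. ennreal (F n z) \<partial>\<nu>) \<le> (\<integral>\<^sup>+z. ennreal (cutoff (snd z / (1 / real (Suc n)))) \<partial>\<nu>)"
      using F_tail by (intro nn_integral_mono ennreal_leI) (simp add: mult.commute del: of_nat_Suc)
    also have "\<dots> < \<infinity>"
      using nn_integral_cutoff_snd_finite
      by (subst nn_integral_cutoff_snd) (simp_all add: ennreal_mult_less_top del: of_nat_Suc)
    finally have int: "integrable \<nu> (F n)"
      using measurable_nu[OF F] F01 by (intro integrableI_nonneg) auto
    have "emeasure \<nu> (S n) = (\<integral>\<^sup>+z. indicator (S n) z \<partial>\<nu>)" using S by simp
    also have "\<dots> \<le> (\<integral>\<^sup>+z. ennreal (F n z) \<partial>\<nu>)"
    proof (rule nn_integral_mono)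
      fix z
      show "indicator (S n) z \<le> ennreal (F n z)"
      proof (cases "z \<in> S n")
        case True
        then have "1 \<le> \<tau> (fst z) * snd z / c" "1 \<le> real (Suc n) * snd z"
          using assms by (simp_all add: S_def)
        then have "F n z = 1" unfolding F_def by (simp add: cutoff_eq_1 del: of_nat_Suc)
        then show ?thesis using True by simp
      qed simp
    qed
    also have "\<dots> = ennreal (LINT z|\<nu>. F n z)"
      using int F01 by (intro nn_integral_eq_integral) auto
    also have "\<dots> \<le> ennreal (cutoff_mass + 1 + D)" using F_le by (rule ennreal_leI)
    finally show ?thesis .
  qed
  then have "(SUP n. emeasure \<nu> (S n)) \<le> ennreal (cutoff_mass + 1 + D)" by (intro SUP_least)
  moreover have "(SUP n. emeasure \<nu> (S n)) = emeasure \<nu> (\<Union>n. S n)"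
  proof (rule SUP_emeasure_incseq)
    show "incseq S"
    proof (rule incseq_SucI, rule subsetI)
      fix n z assume "z \<in> S n"
      moreover from this have "real (Suc n) * snd z \<le> real (Suc (Suc n)) * snd z"
        by (intro mult_right_mono) (auto simp: S_def space_nu)
      ultimately show "z \<in> S (Suc n)" unfolding S_def by auto
    qed
  qed (use S in blast)
  moreover have "(\<Union>n. S n) = {z \<in> space \<nu>. c \<le> \<tau> (fst z) * snd z}"
  proof
    show "{z \<in> space \<nu>. c \<le> \<tau> (fst z) * snd z} \<subseteq> (\<Union>n. S n)"
    proof
      fix z assume z: "z \<in> {z \<in> space \<nu>. c \<le> \<tau> (fst z) * snd z}"
      then have "0 < snd z" by (auto simp: space_nu)
      then obtain n where "1 < real n * snd z" using reals_Archimedean3 by blast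
      then have "1 \<le> real (Suc n) * snd z" using \<open>0 < snd z\<close> by (simp add: algebra_simps)
      with z have "z \<in> S n" by (simp add: S_def del: of_nat_Suc)
      then show "z \<in> (\<Union>n. S n)" by blast
    qed
  qed (auto simp: S_def)
  ultimately show ?thesis by (simp add: le_less_trans[OF _ ennreal_less_top])
qed

text \<open>
  The exchange of limits at the heart of the proof. Multiplying \<open>F\<close> by
  \<open>cutoff (Suc n * snd z)\<close> gives a test function, for which convergence is known.
  As \<open>n\<close> grows, the limits converge to \<open>LINT z|\<nu>. F z\<close> by
  dominated convergence, the finite tail set providing the dominating function. The error
  before the limit in \<open>t\<close> is supported where \<open>F\<close> is nonzero but the
  second coordinate is at most \<open>1 / Suc n\<close>, so the small-radius estimate makes it
  small uniformly for large \<open>t\<close>.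
\<close>

lemma tendsto_tail_function:
  assumes F: "continuous_map Z euclideanreal F"
    and bounded: "\<And>z. z \<in> topspace Z \<Longrightarrow> \<bar>F z\<bar> \<le> K"
    and "0 < c" and supp: "\<And>z. z \<in> topspace Z \<Longrightarrow> F z \<noteq> 0 \<Longrightarrow> c \<le> \<tau> (fst z) * snd z"
  shows "((\<lambda>t. g t * (LINT \<omega>|M. F (\<eta> \<omega>, \<zeta> \<omega> / t))) \<longlongrightarrow> (LINT z|\<nu>. F z)) at_top"
proof -
  obtain D where D: "\<forall>r>0. \<forall>\<^sub>F t in at_top.
      g t * measure M {\<omega>\<in>space M. c \<le> \<tau> (\<eta> \<omega>) * (\<zeta> \<omega> / t) \<and> \<zeta> \<omega> / t \<le> r} \<le> D * r powr (p - \<alpha>)"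
    using joint_tail_small_radius[OF \<open>0 < c\<close>] by blast
  define G where "G n z = F z * cutoff (real (Suc n) * snd z)" for n z
  have G: "continuous_map Z euclideanreal (G n)" for n
    unfolding G_def
    by (intro continuous_map_real_mult F continuous_cutoff continuous_snd) auto
  have G_le: "\<bar>G n z\<bar> \<le> \<bar>F z\<bar>" for n z
    unfolding G_def abs_mult using abs_cutoff_le_1 by (intro mult_right_le_one_le) auto
  have G_K: "\<bar>G n z\<bar> \<le> K" if "z \<in> topspace Z" for n z
    using G_le bounded[OF that] by (rule order_trans)
  have pair: "(\<eta> \<omega>, \<zeta> \<omega> / t) \<in> topspace Z" if "\<omega> \<in> space M" "0 < t" for \<omega> t
    using pair_in_space[OF that(1)] that(2) by simp
  show ?thesis
  proof (rule tendsto_of_uniform_approximation)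
    fix n
    show "((\<lambda>t. g t * (LINT \<omega>|M. G n (\<eta> \<omega>, \<zeta> \<omega> / t))) \<longlongrightarrow> (LINT z|\<nu>. G n z)) at_top"
    proof (rule tendsto_test_function[OF G, where K = K and r = "1 / (2 * real (Suc n))"])
      show "1 / (2 * real (Suc n)) \<le> snd z" if "G n z \<noteq> 0" for z
        using that cutoff_Suc_neq_0 by (auto simp: G_def simp del: of_nat_Suc)
    qed (use G_K in auto)
  next
    let ?S = "{z \<in> space \<nu>. c \<le> \<tau> (fst z) * snd z}"
    show "(\<lambda>n. LINT z|\<nu>. G n z) \<longlonglongrightarrow> (LINT z|\<nu>. F z)"
    proof (rule integral_dominated_convergence[where w = "\<lambda>z. K * indicator ?S z"])
      show "integrable \<nu> (\<lambda>z. K * indicator ?S z)"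
        using tail_set_measurable emeasure_tail_finite[OF \<open>0 < c\<close>] by simp
      show "AE z in \<nu>. (\<lambda>n. G n z) \<longlonglongrightarrow> F z"
      proof (rule AE_I2)
        fix z assume "z \<in> space \<nu>"
        then have "0 < snd z" by (auto simp: space_nu)
        then obtain N where N: "1 < real N * snd z" using reals_Archimedean3 by blast
        have "G n z = F z" if "N \<le> n" for n
        proof -
          have "real N * snd z \<le> real (Suc n) * snd z"
            using that \<open>0 < snd z\<close> by (intro mult_right_mono) auto
          with N show ?thesis by (simp add: G_def cutoff_eq_1 del: of_nat_Suc)
        qed
        then show "(\<lambda>n. G n z) \<longlonglongrightarrow> F z"
          by (intro tendsto_eventually) (auto simp: eventually_sequentially)
      qed
      show "AE z in \<nu>. norm (G n z) \<le> K * indicator ?S z" for n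
      proof (rule AE_I2)
        fix z assume z: "z \<in> space \<nu>"
        then have "z \<in> topspace Z" by (simp add: space_nu)
        then show "norm (G n z) \<le> K * indicator ?S z"
          using G_K[of z n] G_le[of n z] supp[of z] z by (cases "F z = 0") auto
      qed
    qed (intro measurable_nu F G)+
  next
    have "(\<lambda>n. 1 / real (Suc n)) \<longlonglongrightarrow> 0"
      using LIMSEQ_inverse_real_of_nat by (simp add: inverse_eq_divide)
    then have "(\<lambda>n. K * (D * (1 / real (Suc n)) powr (p - \<alpha>))) \<longlonglongrightarrow> K * (D * 0 powr (p - \<alpha>))"
      using alpha_less_p by (intro tendsto_mult tendsto_const tendsto_powr2) auto
    then show "(\<lambda>n. K * (D * (1 / real (Suc n)) powr (p - \<alpha>))) \<longlonglongrightarrow> 0"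
      by simp
  next
    fix n
    have "0 < 1 / real (Suc n)" by simp
    from D[rule_format, OF this] show "\<forall>\<^sub>F t in at_top. \<bar>g t * (LINT \<omega>|M. F (\<eta> \<omega>, \<zeta> \<omega> / t)) - g t * (LINT \<omega>|M. G n (\<eta> \<omega>, \<zeta> \<omega> / t))\<bar>
        \<le> K * (D * (1 / real (Suc n)) powr (p - \<alpha>))"
      using eventually_gt_at_top[of 0]
    proof eventually_elim
      case (elim t)
      let ?S = "{\<omega>\<in>space M. c \<le> \<tau> (\<eta> \<omega>) * (\<zeta> \<omega> / t) \<and> \<zeta> \<omega> / t \<le> 1 / real (Suc n)}"
      obtain \<omega>0 where "\<omega>0 \<in> space M" using not_empty by blast
      then have "0 \<le> K" using bounded[OF pair[OF _ \<open>0 < t\<close>]] abs_ge_zero order_trans by blast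
      have int: "integrable M (\<lambda>\<omega>. F (\<eta> \<omega>, \<zeta> \<omega> / t))" "integrable M (\<lambda>\<omega>. G n (\<eta> \<omega>, \<zeta> \<omega> / t))"
        using measurable_pair[OF F \<open>0 < t\<close>] measurable_pair[OF G \<open>0 < t\<close>] bounded[OF pair] G_K[OF pair] \<open>0 < t\<close>
        by (auto intro!: integrable_const_bound[where B = K])
      have "\<bar>(LINT \<omega>|M. F (\<eta> \<omega>, \<zeta> \<omega> / t)) - (LINT \<omega>|M. G n (\<eta> \<omega>, \<zeta> \<omega> / t))\<bar> =
          \<bar>LINT \<omega>|M. F (\<eta> \<omega>, \<zeta> \<omega> / t) - G n (\<eta> \<omega>, \<zeta> \<omega> / t)\<bar>"
        using int by simp
      also have "\<dots> \<le> (LINT \<omega>|M. \<bar>F (\<eta> \<omega>, \<zeta> \<omega> / t) - G n (\<eta> \<omega>, \<zeta> \<omega> / t)\<bar>)"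
        by (rule integral_abs_bound)
      also have "\<dots> \<le> (LINT \<omega>|M. K * indicator ?S \<omega>)"
      proof (rule integral_mono)
        show "integrable M (\<lambda>\<omega>. \<bar>F (\<eta> \<omega>, \<zeta> \<omega> / t) - G n (\<eta> \<omega>, \<zeta> \<omega> / t)\<bar>)" using int by simp
        show "integrable M (\<lambda>\<omega>. K * indicator ?S \<omega>)"
          by (intro integrable_mult_right integrable_const_bound[where B = 1]) auto
        fix \<omega> assume \<omega>: "\<omega> \<in> space M"
        let ?z = "(\<eta> \<omega>, \<zeta> \<omega> / t)"
        have 1: "F ?z - G n ?z = F ?z * (1 - cutoff (real (Suc n) * (\<zeta> \<omega> / t)))"
          by (simp add: G_def algebra_simps)
        show "\<bar>F ?z - G n ?z\<bar> \<le> K * indicator ?S \<omega>"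
        proof (cases "F ?z = 0 \<or> 1 \<le> real (Suc n) * (\<zeta> \<omega> / t)")
          case True
          then show ?thesis unfolding 1 using \<open>0 \<le> K\<close> by (auto simp: cutoff_eq_1 simp del: of_nat_Suc)
        next
          case False
          then have "\<zeta> \<omega> / t \<le> 1 / real (Suc n)" by (simp add: field_simps)
          moreover have "c \<le> \<tau> (\<eta> \<omega>) * (\<zeta> \<omega> / t)" using supp[OF pair[OF \<omega> \<open>0 < t\<close>]] False by simp
          ultimately have "\<omega> \<in> ?S" using \<omega> by simp
          have "\<bar>F ?z - G n ?z\<bar> \<le> \<bar>F ?z\<bar>"
            unfolding 1 abs_mult using cutoff_nonneg cutoff_le_1 by (intro mult_right_le_one_le) auto
          also have "\<dots> \<le> K" using bounded[OF pair[OF \<omega> \<open>0 < t\<close>]] .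
          finally show ?thesis using \<open>\<omega> \<in> ?S\<close> by simp
        qed
      qed
      also have "\<dots> = K * measure M ?S" by simp
      finally have "g t * \<bar>(LINT \<omega>|M. F (\<eta> \<omega>, \<zeta> \<omega> / t)) - (LINT \<omega>|M. G n (\<eta> \<omega>, \<zeta> \<omega> / t))\<bar> \<le> g t * (K * measure M ?S)"
        using g_nonneg[of t] \<open>0 < t\<close> by (intro mult_left_mono) auto
      also have "\<dots> = K * (g t * measure M ?S)" by simp
      also have "\<dots> \<le> K * (D * (1 / real (Suc n)) powr (p - \<alpha>))"
        using elim \<open>0 \<le> K\<close> by (intro mult_left_mono) auto
      finally show ?case
        using g_nonneg[of t] \<open>0 < t\<close> by (simp add: right_diff_distrib[symmetric] abs_mult del: of_nat_Suc)
    qed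
  qed
qed

end

section \<open>Regular variation of the scaled element\<close>

theorem lemma3p6p4:
  fixes Y :: "'a topology" and T :: "real \<Rightarrow> 'a \<Rightarrow> 'a" and \<tau> :: "'a \<Rightarrow> real"
    and M :: "'w measure" and \<eta> :: "'w \<Rightarrow> 'a" and \<zeta> :: "'w \<Rightarrow> real"
    and g :: "real \<Rightarrow> real" and \<sigma> :: "'a measure" and \<alpha> \<delta> :: real and C :: ennreal
  assumes "perfectly_normal_space Y" and "Hausdorff_space Y" and "Lindelof_space Y"
    and "continuous_scaling Y T"
    and "continuous_finite_modulus Y T \<tau>"
    and "prob_space M"
    and "0 < \<alpha>"
    and "finite_measure \<sigma>" and "sets \<sigma> = sets (borel_of Y)"
    and "0 < emeasure \<sigma> {y \<in> topspace Y. 0 < \<tau> y}"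
    and "regularly_varying M (\<lambda>\<omega>. (\<eta> \<omega>, \<zeta> \<omega>))
           (prod_topology Y (top_of_set {0<..})) (\<lambda>t (y, s). (y, t * s))
           (generated_ideal {topspace Y \<times> B |B. B \<subseteq> {0<..} \<and> 0 < (INF s\<in>B. ereal s)})
           g (\<sigma> \<Otimes>\<^sub>M theta \<alpha>)"
    and "0 < \<delta>" and "C < \<infinity>"
    and "AE \<omega> in M. 0 < \<zeta> \<omega> \<longrightarrow>
           nn_cond_exp M (vimage_algebra (space M) \<zeta> borel)
             (\<lambda>\<omega>. ennreal (\<tau> (\<eta> \<omega>) powr (\<alpha> + \<delta>))) \<omega> \<le> C"
  shows "regularly_varying M (\<lambda>\<omega>. T (\<zeta> \<omega>) (\<eta> \<omega>)) Y T (modulus_ideal Y \<tau>) g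
           (density (distr (\<sigma> \<Otimes>\<^sub>M theta \<alpha>) (borel_of Y) (\<lambda>(y, s). T s y))
              (indicator {y \<in> topspace Y. 0 < \<tau> y}))"
proof -
  interpret prob_space M by fact
  note scaling = \<open>continuous_scaling Y T\<close>[unfolded continuous_scaling_def]
  note modulus = \<open>continuous_finite_modulus Y T \<tau>\<close>[unfolded continuous_finite_modulus_def]
  have \<tau>_cont: "continuous_map Y euclideanreal \<tau>"
    using modulus continuous_map_into_fulltopology by blast
  have \<tau>_nonneg: "0 \<le> \<tau> y" if "y \<in> topspace Y" for y
    using modulus that by (auto simp: continuous_map_def)
  note RV = \<open>regularly_varying M (\<lambda>\<omega>. (\<eta> \<omega>, \<zeta> \<omega>)) _ _ _ g (\<sigma> \<Otimes>\<^sub>M theta \<alpha>)\<close>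
  interpret regularly_varying_pair M Y \<tau> \<eta> \<zeta> g \<sigma> \<alpha> "\<alpha> + \<delta>" C
    by unfold_locales
      (use RV \<tau>_cont \<tau>_nonneg \<open>0 < \<alpha>\<close> \<open>0 < \<delta>\<close> \<open>C < \<infinity>\<close> assms(14) in simp_all)

  define \<phi> where "\<phi> = (\<lambda>(y, s). T s y)"
  define P where "P = {y \<in> topspace Y. 0 < \<tau> y}"
  define \<mu> where "\<mu> = density (distr \<nu> (borel_of Y) \<phi>) (indicator P)"
  have \<phi>_cont: "continuous_map Z Y \<phi>"
    using scaling unfolding \<phi>_def by simp
  have \<phi>_meas: "\<phi> \<in> measurable \<nu> (borel_of Y)"
    using measurable_borel_of_continuous_map[OF \<phi>_cont] by (simp add: measurable_cong_sets[OF sets_nu])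
  have \<tau>_\<phi>: "\<tau> (\<phi> z) = \<tau> (fst z) * snd z" if "z \<in> topspace Z" for z
    using that modulus by (auto simp: \<phi>_def)
  have \<phi>_in: "\<phi> z \<in> topspace Y" if "z \<in> topspace Z" for z
    using continuous_map_image_subset_topspace[OF \<phi>_cont] that by blast
  have P_open: "openin Y P"
  proof -
    have "openin Y {y \<in> topspace Y. \<tau> y \<in> {0<..}}"
      using \<tau>_cont by (rule openin_continuous_map_preimage) simp
    then show ?thesis by (simp add: P_def)
  qed
  have P_sets: "P \<in> sets (borel_of Y)" using P_open by (rule borel_of_openin)
  have sets_\<mu>: "sets \<mu> = sets (borel_of Y)" by (simp add: \<mu>_def)
  \<comment> \<open>All statements about \<open>\<mu>\<close> are pulled back to the product space along \<open>\<phi>\<close>.\<close>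
  have emeasure_\<mu>: "emeasure \<mu> B = emeasure \<nu> {z \<in> space \<nu>. \<phi> z \<in> P \<inter> B}" if "B \<in> sets (borel_of Y)" for B
  proof -
    have "emeasure \<mu> B = emeasure (distr \<nu> (borel_of Y) \<phi>) (P \<inter> B)"
      unfolding \<mu>_def using P_sets that by (intro emeasure_restricted) simp_all
    also have "\<dots> = emeasure \<nu> (\<phi> -` (P \<inter> B) \<inter> space \<nu>)"
      using P_sets that by (intro emeasure_distr \<phi>_meas) simp
    also have "\<phi> -` (P \<inter> B) \<inter> space \<nu> = {z \<in> space \<nu>. \<phi> z \<in> P \<inter> B}" by blast
    finally show ?thesis .
  qed

  \<comment> \<open>A set in the ideal is pulled back into a tail set of finite measure.\<close>
  have finite: "emeasure \<mu> B < \<infinity>" if B_ideal: "B \<in> modulus_ideal Y \<tau>" and B_sets: "B \<in> sets (borel_of Y)" for B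
  proof -
    obtain c where "0 < c" and c: "\<forall>y\<in>B. c \<le> \<tau> y"
      using B_ideal unfolding modulus_ideal_iff by blast
    have "emeasure \<mu> B \<le> emeasure \<nu> {z \<in> space \<nu>. c \<le> \<tau> (fst z) * snd z}"
      unfolding emeasure_\<mu>[OF B_sets]
    proof (intro emeasure_mono tail_set_measurable subsetI)
      fix z assume z: "z \<in> {z \<in> space \<nu>. \<phi> z \<in> P \<inter> B}"
      then have "c \<le> \<tau> (\<phi> z)" "z \<in> topspace Z" using c by (auto simp: space_nu)
      with z \<tau>_\<phi> show "z \<in> {z \<in> space \<nu>. c \<le> \<tau> (fst z) * snd z}" by simp
    qed
    also have "\<dots> < \<infinity>" using \<open>0 < c\<close> by (rule emeasure_tail_finite)
    finally show ?thesis .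
  qed

  have conc: "AE x in \<mu>. x \<in> P"
    unfolding \<mu>_def using P_sets by (subst AE_density) (auto simp: indicator_def)

  \<comment> \<open>If all sets \<open>{y. 1 / Suc n \<le> \<tau> y}\<close> were null, so would be their union \<open>P\<close>. Since \<open>P\<close> pulls back to a product set with \<open>\<sigma> P > 0\<close>, this would annihilate \<open>theta \<alpha>\<close> and with it \<open>\<nu>\<close>, which has positive mass.\<close>
  have mass: "\<exists>B \<in> modulus_ideal Y \<tau> \<inter> sets \<mu>. 0 < emeasure \<mu> B"
  proof (rule ccontr)
    assume none: "\<not> ?thesis"
    define B where "B n = {y \<in> topspace Y. 1 / real (Suc n) \<le> \<tau> y}" for n
    have B: "B n \<in> modulus_ideal Y \<tau> \<inter> sets \<mu>" for n
    proof -
      have "closedin Y {y \<in> topspace Y. \<tau> y \<in> {1 / real (Suc n)..}}"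
        using \<tau>_cont by (rule closedin_continuous_map_preimage) simp
      then have "B n \<in> sets \<mu>" unfolding sets_\<mu> by (intro borel_of_closedin) (simp add: B_def)
      moreover have "B n \<in> modulus_ideal Y \<tau>"
        unfolding modulus_ideal_iff B_def by (intro conjI exI[of _ "1 / real (Suc n)"]) auto
      ultimately show ?thesis by blast
    qed
    with none have "emeasure \<mu> (B n) = 0" for n
      by (auto simp: zero_less_iff_neq_zero)
    moreover have B_sets: "range B \<subseteq> sets \<mu>" using B by blast
    ultimately have null: "emeasure \<mu> (\<Union>n. B n) = 0"
      by (rule emeasure_UN_eq_0)
    have P_le: "P \<subseteq> (\<Union>n. B n)"
    proof
      fix y assume "y \<in> P"
      then have "0 < \<tau> y" "y \<in> topspace Y" by (auto simp: P_def)
      then obtain n where "1 / real (Suc n) < \<tau> y" using nat_approx_posE by blast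
      with \<open>y \<in> topspace Y\<close> have "y \<in> B n" by (simp add: B_def)
      then show "y \<in> (\<Union>n. B n)" by blast
    qed
    have "emeasure \<mu> P = 0"
      using emeasure_mono[OF P_le sets.countable_UN[OF B_sets]] null by simp
    moreover have "{z \<in> space \<nu>. \<phi> z \<in> P} = P \<times> {0<..}"
    proof (rule set_eqI)
      fix z :: "'a \<times> real"
      show "z \<in> {z \<in> space \<nu>. \<phi> z \<in> P} \<longleftrightarrow> z \<in> P \<times> {0<..}"
        using \<tau>_\<phi>[of z] \<phi>_in[of z]
        by (cases z) (auto simp: space_nu P_def zero_less_mult_iff)
    qed
    ultimately have "emeasure \<nu> (P \<times> {0<..}) = 0"
      using emeasure_\<mu>[OF P_sets] by simp
    moreover have "emeasure \<nu> (P \<times> space (theta \<alpha>)) = emeasure \<sigma> P * emeasure (theta \<alpha>) (space (theta \<alpha>))"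
      using P_sets \<open>sets \<sigma> = sets (borel_of Y)\<close>
      by (intro sigma_finite_measure.emeasure_pair_measure_Times sigma_finite_theta) auto
    ultimately have "emeasure (theta \<alpha>) (space (theta \<alpha>)) = 0"
      using \<open>0 < emeasure \<sigma> {y \<in> topspace Y. 0 < \<tau> y}\<close> by (auto simp: space_theta P_def)
    moreover have "emeasure \<nu> (space \<sigma> \<times> space (theta \<alpha>)) = emeasure \<sigma> (space \<sigma>) * emeasure (theta \<alpha>) (space (theta \<alpha>))"
      by (intro sigma_finite_measure.emeasure_pair_measure_Times sigma_finite_theta) auto
    ultimately have "emeasure \<nu> (space \<nu>) = 0"
      by (simp add: space_pair_measure)
    moreover obtain B' where "B' \<in> sets \<nu>" "0 < emeasure \<nu> B'"
      using positive_on_ideal by blast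
    ultimately show False
      using emeasure_space[of \<nu> B'] by simp
  qed

  have lim: "((\<lambda>t. g t * (LINT \<omega>|M. f (T (inverse t) (T (\<zeta> \<omega>) (\<eta> \<omega>))))) \<longlongrightarrow> (LINT x|\<mu>. f x)) at_top"
    if f: "continuous_map (subtopology Y P) euclideanreal f" "bounded (f ` P)"
      and zero: "\<forall>x. x \<notin> P \<longrightarrow> f x = 0" and supp: "Y closure_of {x. f x \<noteq> 0} \<in> modulus_ideal Y \<tau>" for f
  proof -
    obtain c where "0 < c" and c: "\<forall>y\<in>Y closure_of {x. f x \<noteq> 0}. c \<le> \<tau> y"
      using supp unfolding modulus_ideal_iff by blast
    have "Y closure_of {x. f x \<noteq> 0} \<subseteq> P"
    proof
      fix y assume y: "y \<in> Y closure_of {x. f x \<noteq> 0}"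
      then have "c \<le> \<tau> y" "y \<in> topspace Y" using c by (auto simp: in_closure_of)
      with \<open>0 < c\<close> show "y \<in> P" by (simp add: P_def)
    qed
    then have f_cont: "continuous_map Y euclideanreal f"
      using zero by (intro continuous_map_extend_by_zero[OF P_open f(1)]) auto
    have f_supp: "c \<le> \<tau> y" if "f y \<noteq> 0" for y
    proof -
      have "{x. f x \<noteq> 0} \<subseteq> topspace Y" using zero by (auto simp: P_def)
      from subsetD[OF closure_of_subset[OF this], of y] that c show ?thesis by auto
    qed
    obtain K where K: "\<And>y. y \<in> P \<Longrightarrow> \<bar>f y\<bar> \<le> K"
      using f(2) unfolding bounded_iff by auto
    have f_bound: "\<bar>f y\<bar> \<le> max K 0" for y
      using K[of y] zero by (cases "y \<in> P") auto
    have "((\<lambda>t. g t * (LINT \<omega>|M. (f \<circ> \<phi>) (\<eta> \<omega>, \<zeta> \<omega> / t))) \<longlongrightarrow> (LINT z|\<nu>. (f \<circ> \<phi>) z)) at_top"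
    proof (rule tendsto_tail_function[OF continuous_map_compose[OF \<phi>_cont f_cont] _ \<open>0 < c\<close>])
      show "\<bar>(f \<circ> \<phi>) z\<bar> \<le> max K 0" for z by (simp only: comp_apply f_bound)
      show "c \<le> \<tau> (fst z) * snd z" if "z \<in> topspace Z" "(f \<circ> \<phi>) z \<noteq> 0" for z
        using f_supp[of "\<phi> z"] \<tau>_\<phi>[OF that(1)] that(2) by simp
    qed
    moreover have "(LINT z|\<nu>. (f \<circ> \<phi>) z) = (LINT x|\<mu>. f x)"
    proof -
      have f_meas: "f \<in> borel_measurable (borel_of Y)"
        using f_cont by (rule borel_measurable_continuous_map)
      \<comment> \<open>The indicator has to be seen as a real-valued density for the Bochner integral.\<close>
      have "\<mu> = density (distr \<nu> (borel_of Y) \<phi>) (\<lambda>x. ennreal (indicator P x))"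
        unfolding \<mu>_def by (rule arg_cong[where f = "density _"]) (auto simp: indicator_def)
      then have "(LINT x|\<mu>. f x) = (LINT x|distr \<nu> (borel_of Y) \<phi>. indicator P x *\<^sub>R f x)"
        using f_meas P_sets by (simp add: integral_density)
      also have "(\<lambda>x. indicator P x *\<^sub>R f x) = f"
        using zero by (intro ext) (auto simp add: indicator_def)
      also have "(LINT x|distr \<nu> (borel_of Y) \<phi>. f x) = (LINT z|\<nu>. f (\<phi> z))"
        using \<phi>_meas f_meas by (rule integral_distr)
      finally show ?thesis by simp
    qed
    moreover have "\<forall>\<^sub>F t in at_top. g t * (LINT \<omega>|M. (f \<circ> \<phi>) (\<eta> \<omega>, \<zeta> \<omega> / t)) =
        g t * (LINT \<omega>|M. f (T (inverse t) (T (\<zeta> \<omega>) (\<eta> \<omega>))))"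
      using eventually_gt_at_top[of 0]
    proof eventually_elim
      case (elim t)
      have "T (\<zeta> \<omega> / t) (\<eta> \<omega>) = T (inverse t) (T (\<zeta> \<omega>) (\<eta> \<omega>))" if "\<omega> \<in> space M" for \<omega>
        using scaling pair_in_space[OF that] elim by (simp add: divide_inverse mult.commute)
      then show ?case
        by (intro arg_cong[of _ _ "(*) (g t)"] Bochner_Integration.integral_cong) (auto simp: \<phi>_def)
    qed
    ultimately show ?thesis by (auto elim: Lim_transform_eventually)
  qed

  have "(\<lambda>\<omega>. T (\<zeta> \<omega>) (\<eta> \<omega>)) \<in> measurable M (borel_of Y)"
    using measurable_compose[OF pair_measurable measurable_borel_of_continuous_map[OF \<phi>_cont]]
    by (simp add: \<phi>_def)
  then have "regularly_varying M (\<lambda>\<omega>. T (\<zeta> \<omega>) (\<eta> \<omega>)) Y T (modulus_ideal Y \<tau>) g \<mu>"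
    unfolding regularly_varying_def Union_modulus_ideal P_def[symmetric]
    using g_measurable g_nonneg g_at_top sets_\<mu> finite conc mass lim by simp
  then show ?thesis unfolding \<mu>_def \<phi>_def P_def .
qed

end
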